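(* Let $\beta:=(\sqrt{5}+1)/2$. There exists a continuous homomorphism $\Phi:\mathcal{S}_2|[0_+,1_-]\to\mathcal{S}_\beta|[0_+,1_-]$ satisfying the following. (1) $\Phi$ is injective and open. (2) The restriction of $\Phi$ to the unit spaces is a homeomorphism $\mathbb{R}_2\cap[0_+,1_-]\to\mathbb{R}_\beta\cap[0_+,1_-]$ preserving the order, that is, $x<y$ if and only if $\Phi(x)<\Phi(y)$ for $x,y\in\mathbb{R}_2\cap[0_+,1_-]$. Moreover, $\Phi$ extends to an embedding $\mathcal{S}_2\hookrightarrow\mathcal{S}_\beta$ which also has the properties above: it is a continuous, injective and open homomorphism whose restriction to the unit spaces is an order preserving homeomorphism $\mathbb{R}_2\to\mathbb{R}_\beta$.
   Context: For $\lambda>1$, let $\Gamma=\mathbb{Z}[\lambda,\lambda^{-1}]\subset\mathbb{R}$, $\Lambda=\langle\lambda\rangle=\{\lambda^k\mid k\in\mathbb{Z}\}$, $\mathbb{R}_\lambda:=\mathbb{R}_\Gamma$ and $\mathcal{S}_\lambda:=\mathcal{S}(\Gamma,\Lambda)$, where the following notation is used. The space $\mathbb{R}_\Gamma$: as a set $\mathbb{R}_\Gamma=(\mathbb{R}\setminus\Gamma)\sqcup\{t_+,t_-\mid t\in\Gamma\}$, with the canonical surjection $q:\mathbb{R}_\Gamma\to\mathbb{R}$ ($q(t_\pm)=t$, $q(x)=x$ for $x\notin\Gamma$), the total order such that $q(x)<q(y)$ implies $x<y$ and $t_-<t_+$ for $t\in\Gamma$, and the order topology. It is totally disconnected and locally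 compact Hausdorff; the sets $[t_+,s_-]$ ($t<s$ in $\Gamma$) are compact open and form a basis. The group $\Gamma\rtimes\Lambda$ (with $(s,\lambda)(s',\lambda')=(s+\lambda s',\lambda\lambda')$) acts on $\mathbb{R}_\Gamma$ by $(s,\lambda)\cdot x=\lambda x+s$ for $x\in\mathbb{R}\setminus\Gamma$ and $(s,\lambda)\cdot t_\pm=(\lambda t+s)_\pm$. For an action of a discrete group $G$ on $X$, the transformation groupoid $X\rtimes G$ is $X\times G$ with the product topology, unit space $X$ (identified with $X\times\{1\}$), $r(x,\gamma)=x$, $s(x,\gamma)=\gamma^{-1}x$, $(x,\gamma)(\gamma^{-1}x,\gamma')=(x,\gamma\gamma')$. The Stein groupoid is $\mathcal{S}(\Gamma,\Lambda):=\mathbb{R}_\Gamma\rtimes(\Gamma\rtimes\Lambda)$. For an open subset $Y$ of the unit space of a groupoid $\mathcal{G}$, $\mathcal{G}|Y:=r^{-1}(Y)\cap s^{-1}(Y)$ is the reduction. *)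

theory Defs
  imports "HOL-Analysis.Analysis" "HOL-Algebra.Group"
begin

section \<open>The split real line\<close>

text \<open>
  \<open>Pt x\<close> stands for a point \<open>x \<notin> \<Gamma>\<close> of the line; \<open>Minus t\<close> and \<open>Plus t\<close> stand for
  \<open>t\<^sub>-\<close> and \<open>t\<^sub>+\<close>, \<open>t \<in> \<Gamma>\<close>. The type does not mention \<open>\<Gamma>\<close>; the space is cut out of it by
  \<open>split_line\<close> below, on which no point \<open>Pt t\<close> lies between \<open>Minus t\<close> and \<open>Plus t\<close>.
\<close>

datatype split_point = Pt real | Minus real | Plus real

fun split_proj :: "split_point \<Rightarrow> real" where
  "split_proj (Pt x) = x"
| "split_proj (Minus t) = t"
| "split_proj (Plus t) = t"

fun split_side :: "split_point \<Rightarrow> int" where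
  "split_side (Pt x) = 0"
| "split_side (Minus t) = - 1"
| "split_side (Plus t) = 1"

instantiation split_point :: linorder
begin

definition less_split_point :: "split_point \<Rightarrow> split_point \<Rightarrow> bool" where
  "x < y \<longleftrightarrow> split_proj x < split_proj y \<or>
     split_proj x = split_proj y \<and> split_side x < split_side y"

definition less_eq_split_point :: "split_point \<Rightarrow> split_point \<Rightarrow> bool" where
  "x \<le> y \<longleftrightarrow> x < y \<or> x = (y :: split_point)"

instance
proof
  fix x y z :: split_point
  show "x < y \<longleftrightarrow> x \<le> y \<and> \<not> y \<le> x"
    by (auto simp: less_split_point_def less_eq_split_point_def)
  show "x \<le> x"
    by (simp add: less_eq_split_point_def)
  show "x \<le> z" if "x \<le> y" "y \<le> z"
    using that by (auto simp: less_split_point_def less_eq_split_point_def)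
  show "x = y" if "x \<le> y" "y \<le> x"
    using that by (auto simp: less_split_point_def less_eq_split_point_def)
  show "x \<le> y \<or> y \<le> x"
    by (cases x; cases y) (auto simp: less_split_point_def less_eq_split_point_def)
qed

end

definition split_line :: "real set \<Rightarrow> split_point set" where
  "split_line \<Gamma> = Pt ` (- \<Gamma>) \<union> Minus ` \<Gamma> \<union> Plus ` \<Gamma>"

text \<open>
  The order topology of the ordered set \<open>A\<close> itself: the rays are taken at points of \<open>A\<close> only. In
  general this is coarser than the subspace topology of the order topology of the ambient type.
\<close>

definition order_topology_on :: "'a::linorder set \<Rightarrow> 'a topology" where
  "order_topology_on A =
     topology_generated_by
       ({A} \<union> {{x \<in> A. a < x} | a. a \<in> A} \<union> {{x \<in> A. x < a} | a. a \<in> A})"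

definition split_space :: "real set \<Rightarrow> split_point topology" where
  "split_space \<Gamma> = order_topology_on (split_line \<Gamma>)"

definition split_interval :: "real set \<Rightarrow> split_point \<Rightarrow> split_point \<Rightarrow> split_point set" where
  "split_interval \<Gamma> a b = split_line \<Gamma> \<inter> {a..b}"


section \<open>Topological groupoids\<close>

text \<open>
  The arrows of a groupoid are the points of \<open>topspace (gtop \<G>)\<close>, its units are particular
  arrows, and \<open>gmult \<G> g h\<close> is meaningful only when \<open>gsource \<G> g = grange \<G> h\<close>.
\<close>

record 'a top_groupoid =
  gtop :: "'a topology"
  grange :: "'a \<Rightarrow> 'a"
  gsource :: "'a \<Rightarrow> 'a"
  gmult :: "'a \<Rightarrow> 'a \<Rightarrow> 'a"

definition arrows :: "'a top_groupoid \<Rightarrow> 'a set" where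
  "arrows \<G> = topspace (gtop \<G>)"

definition groupoid_hom :: "'a top_groupoid \<Rightarrow> 'b top_groupoid \<Rightarrow> ('a \<Rightarrow> 'b) \<Rightarrow> bool" where
  "groupoid_hom \<G> \<H> \<Phi> \<longleftrightarrow>
     (\<forall>g \<in> arrows \<G>. \<Phi> g \<in> arrows \<H>) \<and>
     (\<forall>g \<in> arrows \<G>. \<forall>h \<in> arrows \<G>. gsource \<G> g = grange \<G> h \<longrightarrow>
        gsource \<H> (\<Phi> g) = grange \<H> (\<Phi> h) \<and>
        \<Phi> (gmult \<G> g h) = gmult \<H> (\<Phi> g) (\<Phi> h))"

definition reduction :: "'a top_groupoid \<Rightarrow> 'a set \<Rightarrow> 'a top_groupoid" where
  "reduction \<G> Y =
     \<G>\<lparr>gtop := subtopology (gtop \<G>) {g \<in> arrows \<G>. grange \<G> g \<in> Y \<and> gsource \<G> g \<in> Y}\<rparr>"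

definition transformation_groupoid ::
  "'x topology \<Rightarrow> ('g, 'm) monoid_scheme \<Rightarrow> ('g \<Rightarrow> 'x \<Rightarrow> 'x) \<Rightarrow> ('x \<times> 'g) top_groupoid" where
  "transformation_groupoid X G act =
     \<lparr>gtop = prod_topology X (discrete_topology (carrier G)),
      grange = (\<lambda>(x, \<gamma>). (x, \<one>\<^bsub>G\<^esub>)),
      gsource = (\<lambda>(x, \<gamma>). (act (inv\<^bsub>G\<^esub> \<gamma>) x, \<one>\<^bsub>G\<^esub>)),
      gmult = (\<lambda>(x, \<gamma>) (x', \<gamma>'). (x, \<gamma> \<otimes>\<^bsub>G\<^esub> \<gamma>'))\<rparr>"


section \<open>Stein groupoids\<close>

definition affine_group :: "real set \<Rightarrow> real set \<Rightarrow> (real \<times> real) monoid" where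
  "affine_group \<Gamma> \<Lambda> =
     \<lparr>carrier = \<Gamma> \<times> \<Lambda>,
      mult = (\<lambda>(s, l) (s', l'). (s + l * s', l * l')),
      one = (0, 1)\<rparr>"

fun affine_act :: "real \<times> real \<Rightarrow> split_point \<Rightarrow> split_point" where
  "affine_act (s, l) (Pt x) = Pt (l * x + s)"
| "affine_act (s, l) (Minus t) = Minus (l * t + s)"
| "affine_act (s, l) (Plus t) = Plus (l * t + s)"

definition stein_groupoid ::
  "real set \<Rightarrow> real set \<Rightarrow> (split_point \<times> (real \<times> real)) top_groupoid" where
  "stein_groupoid \<Gamma> \<Lambda> =
     transformation_groupoid (split_space \<Gamma>) (affine_group \<Gamma> \<Lambda>) affine_act"

text \<open>The unit \<open>(x, 1)\<close> of a Stein groupoid identified with the point \<open>x\<close>.\<close>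

definition unit_at :: "split_point \<Rightarrow> split_point \<times> (real \<times> real)" where
  "unit_at x = (x, (0, 1))"

text \<open>
  The restriction of a homomorphism to the unit spaces, under this identification. A homomorphism
  sends units to units, so the group component dropped by \<open>fst\<close> is the identity \<open>(0, 1)\<close>.
\<close>

definition unit_map ::
  "(split_point \<times> (real \<times> real) \<Rightarrow> split_point \<times> (real \<times> real)) \<Rightarrow> split_point \<Rightarrow> split_point" where
  "unit_map \<Phi> x = fst (\<Phi> (unit_at x))"

definition laurent_ring :: "real \<Rightarrow> real set" where
  "laurent_ring l = {\<Sum>k\<in>K. of_int (c k) * l powi k | (c :: int \<Rightarrow> int) K. finite K}"

definition int_powers :: "real \<Rightarrow> real set" where
  "int_powers l = range (\<lambda>k::int. l powi k)"

definition split_line_of :: "real \<Rightarrow> split_point set" where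
  "split_line_of l = split_line (laurent_ring l)"

definition split_space_of :: "real \<Rightarrow> split_point topology" where
  "split_space_of l = split_space (laurent_ring l)"

definition stein_of :: "real \<Rightarrow> (split_point \<times> (real \<times> real)) top_groupoid" where
  "stein_of l = stein_groupoid (laurent_ring l) (int_powers l)"

definition unit_interval_of :: "real \<Rightarrow> split_point set" where
  "unit_interval_of l = split_interval (laurent_ring l) (Plus 0) (Minus 1)"

definition stein_unit_of :: "real \<Rightarrow> (split_point \<times> (real \<times> real)) top_groupoid" where
  "stein_unit_of l = reduction (stein_of l) (unit_at ` unit_interval_of l)"

end

theory Submission
  imports Defs
begin

text \<open>
  Let \<open>p = 1/\<beta>\<close>, so that \<open>p + p\<^sup>2 = 1\<close>. Subdivide \<open>[0,1]\<close> at \<open>p\<close>, and every interval that arises again in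
  the proportion \<open>p : p\<^sup>2\<close>, while halving the intervals of a second copy of \<open>[0,1]\<close>. Matching the two
  subdivisions, and repeating the pattern between consecutive integers, gives an increasing
  homeomorphism \<open>h\<close> of the line (\<open>de_rham p\<close>), with \<open>h (x/2) = p * h x\<close> and
  \<open>h ((1+x)/2) = p + p\<^sup>2 * h x\<close> for \<open>x \<in> [0,1]\<close>. More generally \<open>h\<close> maps each dyadic interval
  \<open>[k/2^n, (k+1)/2^n]\<close> onto an interval of length a power of \<open>\<beta>\<close> and with end points in
  \<open>\<int>[\<beta>]\<close>, and between these intervals it is a rescaled copy of \<open>h\<close> on \<open>[0,1]\<close> (\<open>de_rham_self_similar\<close>).
  
  Two facts make this the required map. First, near either side of any point an affine map
  \<open>z \<mapsto> 2^m z + s\<close> with dyadic \<open>s\<close> carries a small dyadic interval onto a dyadic interval. As \<open>h\<close> is the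
  same function up to scaling on both, conjugation by \<open>h\<close> turns the germ of this map into the germ of
  an affine map with slope a power of \<open>\<beta>\<close> and translation part in \<open>\<int>[\<beta>]\<close> (\<open>de_rham_intertwines\<close>).
  Sending \<open>(x, \<gamma>)\<close> to \<open>(h x, \<gamma>')\<close>, where \<open>\<gamma>'\<close> has the germ at \<open>h x\<close> of \<open>h \<gamma> h\<inverse>\<close>, is then a homomorphism,
  since germs compose; it is injective because an affine map is determined by its germ, and it is
  continuous and open because \<open>\<gamma>'\<close> is locally constant in \<open>x\<close>. This part is carried out
  for an arbitrary \<open>h\<close> in the locale \<open>germ_conjugacy\<close>.
  
  Secondly, \<open>h\<close> must map \<open>\<int>[1/2]\<close> onto all of \<open>\<int>[\<beta>]\<close>, for otherwise it does not induce a bijection of the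
  split lines. This says that every \<open>y \<in> \<int>[\<beta>] \<inter> [0,1)\<close> is an end point of the subdivision, that is,
  that its orbit under the expanding map \<open>y \<mapsto> \<beta> y\<close> on \<open>[0,p)\<close>, \<open>y \<mapsto> \<beta>\<^sup>2 (y - p)\<close> on \<open>[p,1)\<close>, reaches \<open>0\<close>.
  On Galois conjugates this map contracts towards the interval \<open>[-p, 1]\<close>, so the orbit ends
  with some \<open>y = a + b \<beta> \<in> [0,1)\<close> whose conjugate is close to that interval. The two then differ by less
  than \<open>sqrt 5\<close>, but they differ by \<open>b * sqrt 5\<close>: hence \<open>b = 0\<close> and \<open>y = 0\<close> (\<open>greedy_expansion_finite\<close>).
  
  The homomorphism between the reductions is a restriction of the one between the full groupoids,
  because \<open>h\<close> fixes \<open>0\<close> and \<open>1\<close> and so matches the two unit intervals.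
\<close>

section \<open>Order isomorphisms of split lines\<close>

fun split_map :: "(real \<Rightarrow> real) \<Rightarrow> split_point \<Rightarrow> split_point" where
  "split_map f (Pt x) = Pt (f x)"
| "split_map f (Minus t) = Minus (f t)"
| "split_map f (Plus t) = Plus (f t)"

lemma affine_act_eq_split_map: "affine_act \<gamma> = split_map (\<lambda>z. snd \<gamma> * z + fst \<gamma>)"
proof
  show "affine_act \<gamma> x = split_map (\<lambda>z. snd \<gamma> * z + fst \<gamma>) x" for x
    by (cases \<gamma>; cases x) simp_all
qed

lemma split_map_less_iff:
  assumes "strict_mono f"
  shows "split_map f x < split_map f y \<longleftrightarrow> x < y"
proof -
  have "f a < f b \<longleftrightarrow> a < b" "f a = f b \<longleftrightarrow> a = b" for a b
    using assms by (simp_all add: strict_mono_less strict_mono_eq)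
  then show ?thesis
    by (cases x; cases y) (simp_all add: less_split_point_def)
qed

lemma split_map_le_iff: "strict_mono f \<Longrightarrow> split_map f x \<le> split_map f y \<longleftrightarrow> x \<le> y"
  using split_map_less_iff[of f y x] by (simp flip: not_less)

lemma inj_split_map: "strict_mono f \<Longrightarrow> inj (split_map f)"
  by (rule injI) (metis split_map_less_iff linorder_neqE order_less_irrefl)

lemma split_map_image_split_line:
  assumes "bij f"
  shows "split_map f ` split_line \<Gamma> = split_line (f ` \<Gamma>)"
proof -
  have "f ` (- \<Gamma>) = - f ` \<Gamma>" using assms by (rule bij_image_Compl_eq)
  then show ?thesis unfolding split_line_def image_Un image_image split_map.simps
    by (metis (no_types) image_image)
qed

lemma split_line_points:
  "Pt x \<in> split_line \<Gamma> \<longleftrightarrow> x \<notin> \<Gamma>" "Minus x \<in> split_line \<Gamma> \<longleftrightarrow> x \<in> \<Gamma>"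
  "Plus x \<in> split_line \<Gamma> \<longleftrightarrow> x \<in> \<Gamma>"
  unfolding split_line_def by auto

text \<open>
  Rays, whose end points must belong to the split line, can therefore begin or end over any
  prescribed real number.
\<close>

lemma split_line_surj:
  obtains q where "q \<in> split_line \<Gamma>" "split_proj q = x"
  using split_line_points split_proj.simps by metis

lemma topspace_order_topology_on [simp]: "topspace (order_topology_on A) = A"
  unfolding order_topology_on_def topology_generated_by_topspace by auto

lemma openin_order_topology_on_rays:
  assumes "a \<in> A"
  shows "openin (order_topology_on A) {x \<in> A. a < x}" "openin (order_topology_on A) {x \<in> A. x < a}"
  unfolding order_topology_on_def by (rule topology_generated_by_Basis, use assms in blast)+

lemma openin_order_topology_on_interval:
  assumes "a \<in> A" "b \<in> A"
  shows "openin (order_topology_on A) {x \<in> A. a < x \<and> x < b}"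
proof -
  have "{x \<in> A. a < x \<and> x < b} = {x \<in> A. a < x} \<inter> {x \<in> A. x < b}" by auto
  then show ?thesis using assms by (simp add: openin_Int openin_order_topology_on_rays)
qed

text \<open>
  An order isomorphism matches the rays that generate the two topologies.
\<close>

lemma homeomorphic_map_order_topology_on:
  fixes f :: "'a::linorder \<Rightarrow> 'b::linorder"
  assumes less: "\<And>x y. x \<in> A \<Longrightarrow> y \<in> A \<Longrightarrow> f x < f y \<longleftrightarrow> x < y" and image: "f ` A = B"
  shows "homeomorphic_map (order_topology_on A) (order_topology_on B) f"
proof -
  have cont: "continuous_map (order_topology_on C) (order_topology_on D) g"
    if less: "\<And>x y. x \<in> C \<Longrightarrow> y \<in> C \<Longrightarrow> g x < g y \<longleftrightarrow> x < y" and image: "g ` C = D"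
    for C D and g :: "'c::linorder \<Rightarrow> 'd::linorder"
    unfolding order_topology_on_def[of D]
  proof (rule continuous_on_generated_topo)
    fix U
    assume "U \<in> {D} \<union> {{x \<in> D. a < x} |a. a \<in> D} \<union> {{x \<in> D. x < a} |a. a \<in> D}"
    then consider "U = D" | c where "c \<in> C" "U = {x \<in> D. g c < x}"
      | c where "c \<in> C" "U = {x \<in> D. x < g c}"
      using image by auto
    then show "openin (order_topology_on C) (g -` U \<inter> topspace (order_topology_on C))"
    proof cases
      case 1
      then have *: "g -` U \<inter> topspace (order_topology_on C) = topspace (order_topology_on C)"
        using image by auto
      show ?thesis unfolding * by (rule openin_topspace)
    next
      case 2
      then have "g -` U \<inter> topspace (order_topology_on C) = {x \<in> C. c < x}"
        using image less by auto
      then show ?thesis using 2 openin_order_topology_on_rays by metis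
    next
      case 3
      then have "g -` U \<inter> topspace (order_topology_on C) = {x \<in> C. x < c}"
        using image less by auto
      then show ?thesis using 3 openin_order_topology_on_rays by metis
    qed
  next
    show "g ` topspace (order_topology_on C)
        \<subseteq> \<Union> ({D} \<union> {{x \<in> D. a < x} |a. a \<in> D} \<union> {{x \<in> D. x < a} |a. a \<in> D})"
      using image by auto
  qed
  have inj: "inj_on f A"
    by (rule inj_onI) (metis less linorder_neqE order_less_irrefl)
  define g where "g = inv_into A f"
  have g: "g (f x) = x" if "x \<in> A" for x using inj that by (simp add: g_def)
  have "homeomorphic_maps (order_topology_on A) (order_topology_on B) f g"
    unfolding homeomorphic_maps_def
  proof (intro conjI ballI)
    show "continuous_map (order_topology_on A) (order_topology_on B) f"
      using less image by (rule cont)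
    show "continuous_map (order_topology_on B) (order_topology_on A) g"
      using less image g by (intro cont) (auto simp: image_iff)
  qed (use image g in auto)
  then show ?thesis using homeomorphic_map_maps by blast
qed

section \<open>One-sided neighbourhoods of a split point\<close>

text \<open>
  The punctured side of \<open>t\<close> seen by \<open>Minus t\<close> or \<open>Plus t\<close>, and both sides of an unsplit point. Germs of
  real functions at a split point are taken along this filter. The affine group acts on a split line
  through maps of the real line, and these germs are what remains of a map after localizing
  in the split topology.
\<close>

fun side_filter :: "split_point \<Rightarrow> real filter" where
  "side_filter (Pt x) = nhds x"
| "side_filter (Minus t) = at_left t"
| "side_filter (Plus t) = at_right t"

lemma isCont_strict_mono_surj:
  fixes f :: "real \<Rightarrow> real"
  assumes "strict_mono f" "surj f"
  shows "isCont f x"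
proof -
  have "continuous_on UNIV f"
    by (rule continuous_onI_mono) (simp_all add: assms strict_mono_less_eq)
  then show ?thesis by (simp add: continuous_on_eq_continuous_at)
qed

lemma filterlim_split_map:
  assumes "strict_mono f" "\<And>x. isCont f x"
  shows "filterlim f (side_filter (split_map f x)) (side_filter x)"
proof -
  have nhds: "(f \<longlongrightarrow> f t) (nhds t)" for t
    using assms(2)[of t] by (simp add: isCont_def flip: tendsto_at_iff_tendsto_nhds)
  have side: "(f \<longlongrightarrow> f t) (at t within S)" for t S
    using nhds[of t] by (rule tendsto_mono[rotated]) (rule at_within_le_nhds)
  show ?thesis
  proof (cases x)
    case (Pt t)
    then show ?thesis using nhds by simp
  next
    case (Minus t)
    have "eventually (\<lambda>z. z < t) (at_left t)" by (simp add: eventually_at_filter)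
    then have "eventually (\<lambda>z. f z \<in> {..<f t} \<and> f z \<noteq> f t) (at_left t)"
      by eventually_elim (use assms(1) in \<open>auto simp: strict_mono_less strict_mono_eq\<close>)
    then show ?thesis using Minus side by (simp add: filterlim_at)
  next
    case (Plus t)
    have "eventually (\<lambda>z. z > t) (at_right t)" by (simp add: eventually_at_filter)
    then have "eventually (\<lambda>z. f z \<in> {f t<..} \<and> f z \<noteq> f t) (at_right t)"
      by eventually_elim (use assms(1) in \<open>auto simp: strict_mono_less strict_mono_eq\<close>)
    then show ?thesis using Plus side by (simp add: filterlim_at)
  qed
qed

lemma side_filter_le_nhds: "side_filter x \<le> nhds (split_proj x)"
  by (cases x) (simp_all add: at_within_le_nhds)

lemma side_filter_neq_bot: "side_filter x \<noteq> bot"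
  by (cases x) (simp_all add: nhds_neq_bot)

lemma eventually_side_filter_interval:
  assumes "eventually P (side_filter x)"
  obtains a b where "a < b" "\<And>z. a < z \<Longrightarrow> z < b \<Longrightarrow> P z"
proof (cases x)
  case (Pt t)
  then have "eventually P (nhds t)" using assms by simp
  then have "eventually P (at_right t)" using at_within_le_nhds filter_leD by blast
  then show ?thesis using that unfolding eventually_at_right_field by blast
next
  case (Minus t)
  then show ?thesis using that assms by (auto simp: eventually_at_left_field)
next
  case (Plus t)
  then show ?thesis using that assms by (auto simp: eventually_at_right_field)
qed

lemma eventually_side_filter_inside:
  assumes "a < split_proj x" "split_proj x < b" and P: "\<And>z. a < z \<Longrightarrow> z < b \<Longrightarrow> P z"
  shows "eventually P (side_filter x)"
proof -
  have "eventually (\<lambda>z. z \<in> {a<..<b}) (nhds (split_proj x))"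
    by (rule eventually_nhds_in_open) (use assms in auto)
  then have "eventually (\<lambda>z. z \<in> {a<..<b}) (side_filter x)"
    using side_filter_le_nhds by (rule filter_leD[rotated])
  then show ?thesis by eventually_elim (simp add: P)
qed

text \<open>
  The split topology is fine enough that a property of germs spreads to neighbours. At \<open>Plus t\<close> it
  is essential that \<open>Minus t\<close> is a point of the split line: the ray above it begins with \<open>Plus t\<close>, and
  all its further points near \<open>Plus t\<close> lie over reals on the right of \<open>t\<close>. Both neighbours exist only
  because \<open>t \<in> \<Gamma>\<close>.
\<close>

lemma openin_eventually_side_filter:
  "openin (split_space \<Gamma>) {x \<in> split_line \<Gamma>. eventually P (side_filter x)}"
proof (subst openin_subopen, intro ballI)
  fix x assume "x \<in> {x \<in> split_line \<Gamma>. eventually P (side_filter x)}"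
  then have x: "x \<in> split_line \<Gamma>" and P: "eventually P (side_filter x)" by auto
  let ?T = "{x \<in> split_line \<Gamma>. eventually P (side_filter x)}"
  have "\<exists>u\<in>split_line \<Gamma>. \<exists>v\<in>split_line \<Gamma>. u < x \<and> x < v \<and>
    (\<forall>y\<in>split_line \<Gamma>. u < y \<and> y < v \<longrightarrow> eventually P (side_filter y))"
  proof (cases x)
    case (Pt t)
    then have "eventually P (nhds t)" using P by simp
    then obtain S where S: "open S" "t \<in> S" "\<And>z. z \<in> S \<Longrightarrow> P z"
      unfolding eventually_nhds by blast
    obtain e where e: "0 < e" "ball t e \<subseteq> S" using S openE by blast
    then have Pz: "P z" if "t - e < z" "z < t + e" for z
      using S(3)[of z] that by (auto simp: subset_iff dist_real_def)
    obtain u where u: "u \<in> split_line \<Gamma>" "split_proj u = t - e / 2" by (rule split_line_surj)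
    obtain v where v: "v \<in> split_line \<Gamma>" "split_proj v = t + e / 2" by (rule split_line_surj)
    have "eventually P (side_filter y)" if "u < y" "y < v" for y
    proof -
      have "t - e / 2 \<le> split_proj y" "split_proj y \<le> t + e / 2"
        using that u v by (auto simp: less_split_point_def)
      then show ?thesis using eventually_side_filter_inside[of "t - e" y "t + e"] Pz e by simp
    qed
    moreover have "u < x" "x < v" using u v Pt e by (auto simp: less_split_point_def)
    ultimately show ?thesis using u v by blast
  next
    case (Minus t)
    then have t: "t \<in> \<Gamma>" using x by (simp add: split_line_points)
    obtain b where b: "b < t" "\<And>z. b < z \<Longrightarrow> z < t \<Longrightarrow> P z"
      using P Minus by (auto simp: eventually_at_left_field)
    obtain u where u: "u \<in> split_line \<Gamma>" "split_proj u = (b + t) / 2" by (rule split_line_surj)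
    \<comment> \<open>Below \<open>Plus t\<close> only \<open>Minus t\<close> lies over \<open>t\<close>, because \<open>Pt t\<close> is not on the split line.\<close>
    have "eventually P (side_filter y)" if y: "y \<in> split_line \<Gamma>" "u < y" "y < Plus t" for y
    proof (cases "split_proj y < t")
      case True
      then show ?thesis using eventually_side_filter_inside[of b y t] y u b
        by (auto simp: less_split_point_def)
    next
      case False
      then have "y = Minus t" using y t
        by (cases y) (auto simp: less_split_point_def split_line_points)
      then show ?thesis using P Minus by simp
    qed
    moreover have "u < x" "x < Plus t" using u Minus b by (auto simp: less_split_point_def)
    ultimately show ?thesis using u t split_line_points by blast
  next
    case (Plus t)
    then have t: "t \<in> \<Gamma>" using x by (simp add: split_line_points)
    obtain b where b: "t < b" "\<And>z. t < z \<Longrightarrow> z < b \<Longrightarrow> P z"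
      using P Plus by (auto simp: eventually_at_right_field)
    obtain v where v: "v \<in> split_line \<Gamma>" "split_proj v = (t + b) / 2" by (rule split_line_surj)
    have "eventually P (side_filter y)" if y: "y \<in> split_line \<Gamma>" "Minus t < y" "y < v" for y
    proof (cases "t < split_proj y")
      case True
      then show ?thesis using eventually_side_filter_inside[of t y b] y v b
        by (auto simp: less_split_point_def)
    next
      case False
      then have "y = Plus t" using y t
        by (cases y) (auto simp: less_split_point_def split_line_points)
      then show ?thesis using P Plus by simp
    qed
    moreover have "Minus t < x" "x < v" using v Plus b by (auto simp: less_split_point_def)
    ultimately show ?thesis using v t split_line_points by blast
  qed
  then obtain u v where uv: "u \<in> split_line \<Gamma>" "v \<in> split_line \<Gamma>" "u < x" "x < v"
    "\<And>y. y \<in> split_line \<Gamma> \<Longrightarrow> u < y \<Longrightarrow> y < v \<Longrightarrow> eventually P (side_filter y)" by blast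
  show "\<exists>T. openin (split_space \<Gamma>) T \<and> x \<in> T \<and> T \<subseteq> ?T"
    using uv x openin_order_topology_on_interval[OF uv(1,2)]
    by (intro exI[of _ "{y \<in> split_line \<Gamma>. u < y \<and> y < v}"]) (auto simp: split_space_def)
qed

section \<open>Stein groupoids in coordinates\<close>

lemma arrows_reduction:
  "arrows (reduction \<G> Z) = {g \<in> arrows \<G>. grange \<G> g \<in> Z \<and> gsource \<G> g \<in> Z}"
  by (auto simp: arrows_def reduction_def)

text \<open>
  The inverse of \<open>z \<mapsto> snd \<gamma> * z + fst \<gamma>\<close>. Arrows \<open>(x, \<gamma>)\<close> are indexed by their range \<open>x\<close>, and so this is
  the map that takes the range of an arrow to its source.
\<close>

abbreviation affine_back :: "real \<times> real \<Rightarrow> real \<Rightarrow> real" where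
  "affine_back \<gamma> z \<equiv> (z - fst \<gamma>) / snd \<gamma>"

text \<open>
  What \<open>\<Gamma>\<close> and \<open>\<Lambda>\<close> must satisfy for \<open>affine_group \<Gamma> \<Lambda>\<close> to be a group acting on \<open>split_line \<Gamma>\<close> by
  order preserving maps.
\<close>

locale affine_data =
  fixes \<Gamma> \<Lambda> :: "real set"
  assumes zero: "0 \<in> \<Gamma>"
    and add: "x \<in> \<Gamma> \<Longrightarrow> y \<in> \<Gamma> \<Longrightarrow> x + y \<in> \<Gamma>"
    and uminus: "x \<in> \<Gamma> \<Longrightarrow> - x \<in> \<Gamma>"
    and one: "1 \<in> \<Lambda>"
    and mult: "l \<in> \<Lambda> \<Longrightarrow> m \<in> \<Lambda> \<Longrightarrow> l * m \<in> \<Lambda>"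
    and inverse: "l \<in> \<Lambda> \<Longrightarrow> inverse l \<in> \<Lambda>"
    and pos: "l \<in> \<Lambda> \<Longrightarrow> 0 < l"
    and scale: "l \<in> \<Lambda> \<Longrightarrow> x \<in> \<Gamma> \<Longrightarrow> l * x \<in> \<Gamma>"
begin

lemma affine_inv_closed:
  "\<gamma> \<in> \<Gamma> \<times> \<Lambda> \<Longrightarrow> (- fst \<gamma> / snd \<gamma>, 1 / snd \<gamma>) \<in> \<Gamma> \<times> \<Lambda>"
  using scale[of "inverse (snd \<gamma>)" "- fst \<gamma>"] inverse uminus
  by (auto simp: field_simps)

lemma group_affine_group: "group (affine_group \<Gamma> \<Lambda>)"
proof (rule groupI)
  fix \<gamma> assume g: "\<gamma> \<in> carrier (affine_group \<Gamma> \<Lambda>)"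
  then have "0 < snd \<gamma>" by (auto simp: affine_group_def pos)
  then show "\<exists>\<delta>\<in>carrier (affine_group \<Gamma> \<Lambda>).
      \<delta> \<otimes>\<^bsub>affine_group \<Gamma> \<Lambda>\<^esub> \<gamma> = \<one>\<^bsub>affine_group \<Gamma> \<Lambda>\<^esub>"
    using affine_inv_closed[of \<gamma>] g
    by (intro bexI[of _ "(- fst \<gamma> / snd \<gamma>, 1 / snd \<gamma>)"])
      (auto simp: affine_group_def split_beta)
qed (auto simp: affine_group_def zero one add mult scale algebra_simps)

lemma inv_affine_group:
  assumes "\<gamma> \<in> \<Gamma> \<times> \<Lambda>"
  shows "inv\<^bsub>affine_group \<Gamma> \<Lambda>\<^esub> \<gamma> = (- fst \<gamma> / snd \<gamma>, 1 / snd \<gamma>)"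
proof -
  interpret group "affine_group \<Gamma> \<Lambda>" by (rule group_affine_group)
  have "0 < snd \<gamma>" using assms by (auto simp: pos)
  then show ?thesis using assms affine_inv_closed[OF assms]
    by (intro inv_equality) (auto simp: affine_group_def split_beta)
qed

lemma stein_groupoid_simps:
  "arrows (stein_groupoid \<Gamma> \<Lambda>) = split_line \<Gamma> \<times> (\<Gamma> \<times> \<Lambda>)"
  "gtop (stein_groupoid \<Gamma> \<Lambda>) = prod_topology (split_space \<Gamma>) (discrete_topology (\<Gamma> \<times> \<Lambda>))"
  "grange (stein_groupoid \<Gamma> \<Lambda>) (x, \<gamma>) = unit_at x"
  "\<gamma> \<in> \<Gamma> \<times> \<Lambda> \<Longrightarrow>
     gsource (stein_groupoid \<Gamma> \<Lambda>) (x, \<gamma>) = unit_at (split_map (affine_back \<gamma>) x)"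
  "gmult (stein_groupoid \<Gamma> \<Lambda>) (x, \<gamma>) (y, \<delta>) = (x, fst \<gamma> + snd \<gamma> * fst \<delta>, snd \<gamma> * snd \<delta>)"
proof -
  show "gsource (stein_groupoid \<Gamma> \<Lambda>) (x, \<gamma>) = unit_at (split_map (affine_back \<gamma>) x)"
    if "\<gamma> \<in> \<Gamma> \<times> \<Lambda>"
    using that by (simp add: stein_groupoid_def transformation_groupoid_def inv_affine_group
        affine_act_eq_split_map unit_at_def diff_divide_distrib)
      (simp add: affine_group_def)
qed (auto simp: stein_groupoid_def transformation_groupoid_def affine_group_def arrows_def
      unit_at_def split_space_def split_beta)

lemma affine_mult_closed:
  "\<gamma> \<in> \<Gamma> \<times> \<Lambda> \<Longrightarrow> \<delta> \<in> \<Gamma> \<times> \<Lambda> \<Longrightarrow> (fst \<gamma> + snd \<gamma> * fst \<delta>, snd \<gamma> * snd \<delta>) \<in> \<Gamma> \<times> \<Lambda>"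
  using add mult scale by auto

lemma affine_back_mono: "\<gamma> \<in> \<Gamma> \<times> \<Lambda> \<Longrightarrow> strict_mono (affine_back \<gamma>)"
  using pos by (intro strict_monoI divide_strict_right_mono) auto

lemma affine_back_split_line:
  assumes "\<gamma> \<in> \<Gamma> \<times> \<Lambda>" "x \<in> split_line \<Gamma>"
  shows "split_map (affine_back \<gamma>) x \<in> split_line \<Gamma>"
proof -
  have 1: "affine_back \<gamma> z \<in> \<Gamma>" if "z \<in> \<Gamma>" for z
  proof -
    have "inverse (snd \<gamma>) * (z + - fst \<gamma>) \<in> \<Gamma>"
      by (rule scale[OF inverse add[OF that uminus]]) (use assms(1) in auto)
    then show ?thesis by (simp add: divide_inverse mult.commute)
  qed
  have "z \<in> \<Gamma>" if "affine_back \<gamma> z \<in> \<Gamma>" for z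
  proof -
    have "0 < snd \<gamma>" using assms pos by auto
    then have "z = snd \<gamma> * affine_back \<gamma> z + fst \<gamma>" by simp
    also have "\<dots> \<in> \<Gamma>"
      by (rule add[OF scale[OF _ that]]) (use assms(1) in auto)
    finally show ?thesis .
  qed
  then have iff: "affine_back \<gamma> z \<in> \<Gamma> \<longleftrightarrow> z \<in> \<Gamma>" for z using 1 by blast
  show ?thesis using assms(2) by (cases x) (simp_all only: split_map.simps split_line_points iff not_False_eq_True)
qed

end

section \<open>The groupoid map induced by conjugating germs\<close>

text \<open>
  Near \<open>x\<close>, \<open>h = \<gamma>' \<circ> h \<circ> \<gamma>\<inverse>\<close>: the germ of \<open>\<gamma>'\<close> is that of \<open>\<gamma>\<close> conjugated by \<open>h\<close>. It is phrased at the
  range \<open>x\<close> of the arrow \<open>(x, \<gamma>)\<close>, so that for fixed \<open>\<gamma>\<close> and \<open>\<gamma>'\<close> it is an open condition on the first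
  coordinate of the groupoid.
\<close>

definition intertwines ::
  "(real \<Rightarrow> real) \<Rightarrow> real \<times> real \<Rightarrow> real \<times> real \<Rightarrow> split_point \<Rightarrow> bool" where
  "intertwines h \<gamma> \<gamma>' x \<longleftrightarrow>
     eventually (\<lambda>z. h z = snd \<gamma>' * h (affine_back \<gamma> z) + fst \<gamma>') (side_filter x)"

text \<open>
  The hypothesis \<open>intertwines_ex\<close> says that conjugation by \<open>h\<close> turns the germs of the affine
  maps in \<open>\<Gamma> \<times> \<Lambda>\<close> into germs of affine maps in \<open>\<Gamma>' \<times> \<Lambda>'\<close>. The element \<open>\<gamma>'\<close> may depend on the point \<open>x\<close>: in
  general no homomorphism between the two groups lies behind the groupoid map.
\<close>

locale germ_conjugacy = dom: affine_data \<Gamma> \<Lambda> + cod: affine_data \<Gamma>' \<Lambda>'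
  for \<Gamma> \<Lambda> \<Gamma>' \<Lambda>' :: "real set" +
  fixes h :: "real \<Rightarrow> real"
  assumes mono: "strict_mono h"
    and surj: "surj h"
    and image: "h ` \<Gamma> = \<Gamma>'"
    and intertwines_ex: "x \<in> split_line \<Gamma> \<Longrightarrow> \<gamma> \<in> \<Gamma> \<times> \<Lambda> \<Longrightarrow> \<exists>\<gamma>'\<in>\<Gamma>' \<times> \<Lambda>'. intertwines h \<gamma> \<gamma>' x"
begin

lemma continuous: "isCont h x"
  using mono surj by (rule isCont_strict_mono_surj)

lemma h_eq_iff: "h a = h b \<longleftrightarrow> a = b"
  using mono by (rule strict_mono_eq)

text \<open>
  Surjectivity depends on \<open>h ` \<Gamma> = \<Gamma>'\<close> and not just on an inclusion: the image must be split at every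
  point of \<open>\<Gamma>'\<close>.
\<close>

lemma split_map_image: "split_map h ` split_line \<Gamma> = split_line \<Gamma>'"
proof -
  have "bij h" using surj h_eq_iff by (auto simp: bij_def inj_def)
  then show ?thesis using split_map_image_split_line image by metis
qed

lemma homeomorphic_split_map: "homeomorphic_map (split_space \<Gamma>) (split_space \<Gamma>') (split_map h)"
  unfolding split_space_def
  by (rule homeomorphic_map_order_topology_on)
    (simp_all add: split_map_less_iff mono split_map_image)

text \<open>
  Two affine maps with the same germ agree at two points, hence everywhere. This and the next lemma
  make the groupoid map well defined and injective.
\<close>

lemma intertwines_unique:
  assumes "intertwines h \<gamma> \<gamma>' x" "intertwines h \<gamma> \<delta>' x" "\<gamma> \<in> \<Gamma> \<times> \<Lambda>"
  shows "\<gamma>' = \<delta>'"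
proof -
  have "eventually (\<lambda>z. snd \<gamma>' * h (affine_back \<gamma> z) + fst \<gamma>'
      = snd \<delta>' * h (affine_back \<gamma> z) + fst \<delta>') (side_filter x)"
    using assms(1,2) unfolding intertwines_def by eventually_elim simp
  then obtain a b where ab: "a < b" and eq: "\<And>z. a < z \<Longrightarrow> z < b \<Longrightarrow>
      snd \<gamma>' * h (affine_back \<gamma> z) + fst \<gamma>' = snd \<delta>' * h (affine_back \<gamma> z) + fst \<delta>'"
    by (rule eventually_side_filter_interval) blast
  obtain u where u: "a < u" "u < b" using ab dense by blast
  obtain v where v: "u < v" "v < b" using u dense by blast
  have "affine_back \<gamma> u < affine_back \<gamma> v"
    by (rule strict_monoD[OF dom.affine_back_mono[OF assms(3)] v(1)])
  then have less: "h (affine_back \<gamma> u) < h (affine_back \<gamma> v)"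
    using mono by (simp add: strict_mono_less)
  \<comment> \<open>The difference of the two identities at \<open>u\<close> and \<open>v\<close>.\<close>
  have "(snd \<gamma>' - snd \<delta>') * (h (affine_back \<gamma> v) - h (affine_back \<gamma> u)) = 0"
    using eq[of u] eq[of v] u v by (simp add: algebra_simps)
  then have "snd \<gamma>' = snd \<delta>'" using less by simp
  then show ?thesis using eq[of u] u by (simp add: prod_eq_iff)
qed

lemma intertwines_unique':
  assumes "intertwines h \<gamma> \<gamma>' x" "intertwines h \<delta> \<gamma>' x"
    and "\<gamma> \<in> \<Gamma> \<times> \<Lambda>" "\<delta> \<in> \<Gamma> \<times> \<Lambda>" "\<gamma>' \<in> \<Gamma>' \<times> \<Lambda>'"
  shows "\<gamma> = \<delta>"
proof -
  have pos: "0 < snd \<gamma>'" "0 < snd \<gamma>" "0 < snd \<delta>" using assms dom.pos cod.pos by auto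
  have "eventually (\<lambda>z. affine_back \<gamma> z = affine_back \<delta> z) (side_filter x)"
    using assms(1,2) unfolding intertwines_def
    by eventually_elim (use pos(1) in \<open>simp add: h_eq_iff\<close>)
  then obtain a b where ab: "a < b"
    and eq: "\<And>z. a < z \<Longrightarrow> z < b \<Longrightarrow> affine_back \<gamma> z = affine_back \<delta> z"
    by (rule eventually_side_filter_interval) blast
  obtain u where u: "a < u" "u < b" using ab dense by blast
  obtain v where v: "u < v" "v < b" using u dense by blast
  have "(u - fst \<gamma>) * snd \<delta> = (u - fst \<delta>) * snd \<gamma>" "(v - fst \<gamma>) * snd \<delta> = (v - fst \<delta>) * snd \<gamma>"
    using eq[of u] eq[of v] u v pos by (simp_all add: frac_eq_eq)
  moreover from this have "(v - u) * (snd \<delta> - snd \<gamma>) = 0" by (simp add: algebra_simps)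
  ultimately show ?thesis using v pos by (simp add: prod_eq_iff)
qed

definition cocycle :: "split_point \<Rightarrow> real \<times> real \<Rightarrow> real \<times> real" where
  "cocycle x \<gamma> = (THE \<gamma>'. \<gamma>' \<in> \<Gamma>' \<times> \<Lambda>' \<and> intertwines h \<gamma> \<gamma>' x)"

lemma cocycle:
  assumes "x \<in> split_line \<Gamma>" "\<gamma> \<in> \<Gamma> \<times> \<Lambda>"
  shows "cocycle x \<gamma> \<in> \<Gamma>' \<times> \<Lambda>'" "intertwines h \<gamma> (cocycle x \<gamma>) x"
proof -
  have "\<exists>!\<gamma>'. \<gamma>' \<in> \<Gamma>' \<times> \<Lambda>' \<and> intertwines h \<gamma> \<gamma>' x"
    using intertwines_ex[OF assms] intertwines_unique[OF _ _ assms(2)] by blast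
  then have "cocycle x \<gamma> \<in> \<Gamma>' \<times> \<Lambda>' \<and> intertwines h \<gamma> (cocycle x \<gamma>) x"
    unfolding cocycle_def by (rule theI')
  then show "cocycle x \<gamma> \<in> \<Gamma>' \<times> \<Lambda>'" "intertwines h \<gamma> (cocycle x \<gamma>) x" by auto
qed

lemma cocycle_eqI:
  assumes "x \<in> split_line \<Gamma>" "\<gamma> \<in> \<Gamma> \<times> \<Lambda>" "intertwines h \<gamma> \<gamma>' x"
  shows "cocycle x \<gamma> = \<gamma>'"
  using intertwines_unique[OF cocycle(2)[OF assms(1,2)] assms(3,2)] .

definition stein_map :: "split_point \<times> (real \<times> real) \<Rightarrow> split_point \<times> (real \<times> real)" where
  "stein_map = (\<lambda>(x, \<gamma>). (split_map h x, cocycle x \<gamma>))"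

lemma stein_map_arrows:
  "x \<in> split_line \<Gamma> \<Longrightarrow> \<gamma> \<in> \<Gamma> \<times> \<Lambda> \<Longrightarrow> stein_map (x, \<gamma>) \<in> split_line \<Gamma>' \<times> (\<Gamma>' \<times> \<Lambda>')"
  using cocycle(1) split_map_image by (auto simp: stein_map_def)

text \<open>
  The conjugated germ takes range to source because \<open>h\<close> is continuous, so that the identity between
  germs also holds at the real number below \<open>x\<close>; sides are preserved since all maps are increasing.
\<close>

lemma split_map_affine_back:
  assumes "x \<in> split_line \<Gamma>" "\<gamma> \<in> \<Gamma> \<times> \<Lambda>"
  shows "split_map (affine_back (cocycle x \<gamma>)) (split_map h x) = split_map h (split_map (affine_back \<gamma>) x)"
proof -
  define t where "t = split_proj x"
  define \<gamma>' where "\<gamma>' = cocycle x \<gamma>"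
  have pos: "0 < snd \<gamma>'" "0 < snd \<gamma>" using assms cocycle(1)[OF assms] dom.pos cod.pos by (auto simp: \<gamma>'_def)
  have cont: "isCont (\<lambda>z. snd \<gamma>' * h (affine_back \<gamma> z) + fst \<gamma>') t"
    using pos by (intro continuous_intros isCont_o2[OF _ continuous]) simp
  have lim: "(f \<longlongrightarrow> f t) (side_filter x)" if "isCont f t" for f :: "real \<Rightarrow> real"
    using that tendsto_mono[OF side_filter_le_nhds]
    by (simp add: t_def isCont_def tendsto_at_iff_tendsto_nhds)
  have "(h \<longlongrightarrow> snd \<gamma>' * h (affine_back \<gamma> t) + fst \<gamma>') (side_filter x)"
    using cocycle(2)[OF assms] lim[OF cont] unfolding intertwines_def \<gamma>'_def
    by (subst filterlim_cong[OF refl refl]) auto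
  then have "h t = snd \<gamma>' * h (affine_back \<gamma> t) + fst \<gamma>'"
    using tendsto_unique[OF side_filter_neq_bot] lim[OF continuous] by blast
  then have "affine_back \<gamma>' (h t) = h (affine_back \<gamma> t)" using pos by (simp add: field_simps)
  then show ?thesis unfolding t_def \<gamma>'_def by (cases x) simp_all
qed

text \<open>
  Conjugation by \<open>h\<close> commutes with composition of germs: the germ of \<open>\<gamma>\<inverse>\<close> at \<open>x\<close> carries one-sided
  neighbourhoods of \<open>x\<close> to those of \<open>y\<close>, where the germ of \<open>\<delta>\<close> is taken, and by uniqueness a germ
  identity gives the value of the cocycle.
\<close>

lemma cocycle_mult:
  assumes "x \<in> split_line \<Gamma>" "\<gamma> \<in> \<Gamma> \<times> \<Lambda>" "\<delta> \<in> \<Gamma> \<times> \<Lambda>"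
    and y: "y = split_map (affine_back \<gamma>) x"
  shows "cocycle x (fst \<gamma> + snd \<gamma> * fst \<delta>, snd \<gamma> * snd \<delta>) =
    (fst (cocycle x \<gamma>) + snd (cocycle x \<gamma>) * fst (cocycle y \<delta>), snd (cocycle x \<gamma>) * snd (cocycle y \<delta>))"
proof (rule cocycle_eqI)
  have pos: "0 < snd \<gamma>" "0 < snd \<delta>" using assms dom.pos by auto
  have ys: "y \<in> split_line \<Gamma>" unfolding y by (rule dom.affine_back_split_line) (use assms in auto)
  have "filterlim (affine_back \<gamma>) (side_filter y) (side_filter x)"
    unfolding y
    by (rule filterlim_split_map[OF dom.affine_back_mono[OF assms(2)]])
      (use pos in \<open>auto intro!: continuous_intros\<close>)
  then have E: "eventually (\<lambda>z. h (affine_back \<gamma> z) =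
      snd (cocycle y \<delta>) * h (affine_back \<delta> (affine_back \<gamma> z)) + fst (cocycle y \<delta>)) (side_filter x)"
    using cocycle(2)[OF ys assms(3), unfolded intertwines_def]
    by (rule eventually_compose_filterlim[rotated])
  have comp: "affine_back \<delta> (affine_back \<gamma> z)
      = affine_back (fst \<gamma> + snd \<gamma> * fst \<delta>, snd \<gamma> * snd \<delta>) z" for z
    using pos by (simp add: field_simps)
  from E cocycle(2)[OF assms(1,2)] show "intertwines h (fst \<gamma> + snd \<gamma> * fst \<delta>, snd \<gamma> * snd \<delta>)
     (fst (cocycle x \<gamma>) + snd (cocycle x \<gamma>) * fst (cocycle y \<delta>), snd (cocycle x \<gamma>) * snd (cocycle y \<delta>)) x"
    unfolding intertwines_def
  proof eventually_elim
    case (elim z)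
    have "h z = snd (cocycle x \<gamma>) * (snd (cocycle y \<delta>) * h (affine_back \<delta> (affine_back \<gamma> z))
        + fst (cocycle y \<delta>)) + fst (cocycle x \<gamma>)"
      unfolding elim(2) unfolding elim(1) ..
    then show ?case unfolding comp by (simp only: distrib_left mult.assoc add.assoc fst_conv snd_conv)
  qed
qed (rule assms(1) dom.affine_mult_closed[OF assms(2,3)])+

lemma groupoid_hom_stein_map:
  "groupoid_hom (stein_groupoid \<Gamma> \<Lambda>) (stein_groupoid \<Gamma>' \<Lambda>') stein_map"
  unfolding groupoid_hom_def
proof (intro conjI ballI impI)
  fix g assume "g \<in> arrows (stein_groupoid \<Gamma> \<Lambda>)"
  then show "stein_map g \<in> arrows (stein_groupoid \<Gamma>' \<Lambda>')"
    using stein_map_arrows by (auto simp: dom.stein_groupoid_simps cod.stein_groupoid_simps)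
next
  fix g k
  assume "g \<in> arrows (stein_groupoid \<Gamma> \<Lambda>)" "k \<in> arrows (stein_groupoid \<Gamma> \<Lambda>)"
    and comp: "gsource (stein_groupoid \<Gamma> \<Lambda>) g = grange (stein_groupoid \<Gamma> \<Lambda>) k"
  then obtain x \<gamma> y \<delta> where g: "g = (x, \<gamma>)" "x \<in> split_line \<Gamma>" "\<gamma> \<in> \<Gamma> \<times> \<Lambda>"
    and k: "k = (y, \<delta>)" "y \<in> split_line \<Gamma>" "\<delta> \<in> \<Gamma> \<times> \<Lambda>"
    by (force simp: dom.stein_groupoid_simps)
  have y: "y = split_map (affine_back \<gamma>) x"
    using comp g k by (simp add: dom.stein_groupoid_simps unit_at_def)
  show "gsource (stein_groupoid \<Gamma>' \<Lambda>') (stein_map g) = grange (stein_groupoid \<Gamma>' \<Lambda>') (stein_map k)"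
    using split_map_affine_back[OF g(2,3)] cocycle(1)[OF g(2,3)]
    by (simp add: g(1) k(1) stein_map_def cod.stein_groupoid_simps y)
  show "stein_map (gmult (stein_groupoid \<Gamma> \<Lambda>) g k)
      = gmult (stein_groupoid \<Gamma>' \<Lambda>') (stein_map g) (stein_map k)"
    using cocycle_mult[OF g(2,3) k(3) y]
    by (simp add: g(1) k(1) stein_map_def cod.stein_groupoid_simps dom.stein_groupoid_simps)
qed

lemma inj_on_stein_map: "inj_on stein_map (arrows (stein_groupoid \<Gamma> \<Lambda>))"
proof (rule inj_onI)
  fix g k
  assume "g \<in> arrows (stein_groupoid \<Gamma> \<Lambda>)" "k \<in> arrows (stein_groupoid \<Gamma> \<Lambda>)"
    and eq: "stein_map g = stein_map k"
  then obtain x \<gamma> y \<delta> where g: "g = (x, \<gamma>)" "x \<in> split_line \<Gamma>" "\<gamma> \<in> \<Gamma> \<times> \<Lambda>"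
    and k: "k = (y, \<delta>)" "y \<in> split_line \<Gamma>" "\<delta> \<in> \<Gamma> \<times> \<Lambda>"
    by (force simp: dom.stein_groupoid_simps)
  have "split_map h x = split_map h y" "cocycle x \<gamma> = cocycle y \<delta>"
    using eq g k by (auto simp: stein_map_def)
  then have xy: "x = y" using inj_split_map[OF mono] by (simp add: inj_eq)
  then have "\<gamma> = \<delta>"
    using intertwines_unique'[of \<gamma> "cocycle x \<gamma>" x \<delta>] cocycle[OF g(2,3)] cocycle[OF k(2,3)]
      \<open>cocycle x \<gamma> = cocycle y \<delta>\<close> g k by simp
  then show "g = k" using g k xy by simp
qed

text \<open>
  Locally the groupoid map is \<open>split_map h\<close> times a constant, which reduces its continuity and
  openness to those of \<open>split_map h\<close>.
\<close>

lemma stein_map_locally_product: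
  assumes "x \<in> split_line \<Gamma>" "\<gamma> \<in> \<Gamma> \<times> \<Lambda>"
  obtains N where "openin (split_space \<Gamma>) N" "x \<in> N" "N \<subseteq> split_line \<Gamma>"
    "\<And>y. y \<in> N \<Longrightarrow> stein_map (y, \<gamma>) = (split_map h y, cocycle x \<gamma>)"
proof
  let ?N = "{y \<in> split_line \<Gamma>. intertwines h \<gamma> (cocycle x \<gamma>) y}"
  show "openin (split_space \<Gamma>) ?N"
    unfolding intertwines_def by (rule openin_eventually_side_filter)
  show "x \<in> ?N" using assms cocycle(2) by simp
  show "stein_map (y, \<gamma>) = (split_map h y, cocycle x \<gamma>)" if "y \<in> ?N" for y
    using that cocycle_eqI assms(2) by (simp add: stein_map_def)
qed auto

lemma continuous_stein_map:
  "continuous_map (gtop (stein_groupoid \<Gamma> \<Lambda>)) (gtop (stein_groupoid \<Gamma>' \<Lambda>')) stein_map"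
  unfolding dom.stein_groupoid_simps cod.stein_groupoid_simps
proof (rule continuous_map_openin_preimage_eq[THEN iffD2], intro conjI allI impI)
  show "stein_map \<in> topspace (prod_topology (split_space \<Gamma>) (discrete_topology (\<Gamma> \<times> \<Lambda>)))
      \<rightarrow> topspace (prod_topology (split_space \<Gamma>') (discrete_topology (\<Gamma>' \<times> \<Lambda>')))"
    using stein_map_arrows by (fastforce simp: split_space_def)
next
  fix U assume U: "openin (prod_topology (split_space \<Gamma>') (discrete_topology (\<Gamma>' \<times> \<Lambda>'))) U"
  show "openin (prod_topology (split_space \<Gamma>) (discrete_topology (\<Gamma> \<times> \<Lambda>)))
     (topspace (prod_topology (split_space \<Gamma>) (discrete_topology (\<Gamma> \<times> \<Lambda>))) \<inter> stein_map -` U)"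
    unfolding openin_prod_topology_alt[of "split_space \<Gamma>"]
  proof (intro allI impI)
    fix x \<gamma>
    assume "(x, \<gamma>) \<in> topspace (prod_topology (split_space \<Gamma>) (discrete_topology (\<Gamma> \<times> \<Lambda>)))
        \<inter> stein_map -` U"
    then have x: "x \<in> split_line \<Gamma>" "\<gamma> \<in> \<Gamma> \<times> \<Lambda>" and "(split_map h x, cocycle x \<gamma>) \<in> U"
      by (auto simp: split_space_def stein_map_def)
    then obtain V W where V: "openin (split_space \<Gamma>') V" "split_map h x \<in> V"
      and W: "cocycle x \<gamma> \<in> W" "V \<times> W \<subseteq> U"
      using U unfolding openin_prod_topology_alt by meson
    obtain N where N: "openin (split_space \<Gamma>) N" "x \<in> N" "N \<subseteq> split_line \<Gamma>"
      "\<And>y. y \<in> N \<Longrightarrow> stein_map (y, \<gamma>) = (split_map h y, cocycle x \<gamma>)"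
      using stein_map_locally_product[OF x] by blast
    have "openin (split_space \<Gamma>) {y \<in> topspace (split_space \<Gamma>). split_map h y \<in> V}"
      using homeomorphic_imp_continuous_map[OF homeomorphic_split_map] V(1)
      by (rule openin_continuous_map_preimage)
    then have "openin (split_space \<Gamma>) ({y \<in> topspace (split_space \<Gamma>). split_map h y \<in> V} \<inter> N)"
      using N(1) by (rule openin_Int)
    then show "\<exists>U' V'. openin (split_space \<Gamma>) U' \<and> openin (discrete_topology (\<Gamma> \<times> \<Lambda>)) V' \<and>
        x \<in> U' \<and> \<gamma> \<in> V' \<and> U' \<times> V' \<subseteq>
        topspace (prod_topology (split_space \<Gamma>) (discrete_topology (\<Gamma> \<times> \<Lambda>))) \<inter> stein_map -` U"
      using x V(2) W N
      by (intro exI[of _ "{y \<in> topspace (split_space \<Gamma>). split_map h y \<in> V} \<inter> N"] exI[of _ "{\<gamma>}"])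
        (auto simp: split_space_def)
  qed
qed

lemma open_stein_map:
  "open_map (gtop (stein_groupoid \<Gamma> \<Lambda>)) (gtop (stein_groupoid \<Gamma>' \<Lambda>')) stein_map"
  unfolding dom.stein_groupoid_simps cod.stein_groupoid_simps open_map_def
proof (intro allI impI)
  fix U assume U: "openin (prod_topology (split_space \<Gamma>) (discrete_topology (\<Gamma> \<times> \<Lambda>))) U"
  then have sub: "U \<subseteq> split_line \<Gamma> \<times> (\<Gamma> \<times> \<Lambda>)"
    by (auto dest!: openin_subset simp: split_space_def)
  show "openin (prod_topology (split_space \<Gamma>') (discrete_topology (\<Gamma>' \<times> \<Lambda>'))) (stein_map ` U)"
    unfolding openin_prod_topology_alt[of "split_space \<Gamma>'"]
  proof (intro allI impI)
    fix x' \<gamma>' assume "(x', \<gamma>') \<in> stein_map ` U"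
    then obtain x \<gamma> where x: "(x, \<gamma>) \<in> U" "x' = split_map h x" "\<gamma>' = cocycle x \<gamma>"
      by (auto simp: stein_map_def)
    then have xs: "x \<in> split_line \<Gamma>" "\<gamma> \<in> \<Gamma> \<times> \<Lambda>" using sub by auto
    obtain V W where V: "openin (split_space \<Gamma>) V" "x \<in> V" and W: "\<gamma> \<in> W" "V \<times> W \<subseteq> U"
      using U x(1) unfolding openin_prod_topology_alt by meson
    obtain N where N: "openin (split_space \<Gamma>) N" "x \<in> N" "N \<subseteq> split_line \<Gamma>"
      "\<And>y. y \<in> N \<Longrightarrow> stein_map (y, \<gamma>) = (split_map h y, cocycle x \<gamma>)"
      using stein_map_locally_product[OF xs] by blast
    have "openin (split_space \<Gamma>') (split_map h ` (V \<inter> N))"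
      using homeomorphic_imp_open_map[OF homeomorphic_split_map] openin_Int[OF V(1) N(1)]
      by (simp add: open_map_def)
    moreover have "(split_map h y, \<gamma>') \<in> stein_map ` U" if "y \<in> V \<inter> N" for y
      using that N(4)[of y] W x(3) by (intro image_eqI[of _ _ "(y, \<gamma>)"]) auto
    ultimately show "\<exists>U' V'. openin (split_space \<Gamma>') U' \<and> openin (discrete_topology (\<Gamma>' \<times> \<Lambda>')) V' \<and>
        x' \<in> U' \<and> \<gamma>' \<in> V' \<and> U' \<times> V' \<subseteq> stein_map ` U"
      using x V(2) N(2) cocycle(1)[OF xs]
      by (intro exI[of _ "split_map h ` (V \<inter> N)"] exI[of _ "{\<gamma>'}"]) auto
  qed
qed

lemma unit_map_stein_map: "unit_map stein_map = split_map h"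
  by (simp add: fun_eq_iff unit_map_def unit_at_def stein_map_def)

context
  fixes Y Y'
  assumes Y: "Y \<subseteq> split_line \<Gamma>" and Y': "split_map h ` Y = Y'"
begin

text \<open>
  That membership is reflected, and not only preserved, is what keeps the restricted map open: the
  image of the reduction is cut out of the full image by the target reduction.
\<close>

lemma in_reduction_iff:
  assumes "g \<in> arrows (stein_groupoid \<Gamma> \<Lambda>)"
  shows "grange (stein_groupoid \<Gamma>' \<Lambda>') (stein_map g) \<in> unit_at ` Y' \<and>
         gsource (stein_groupoid \<Gamma>' \<Lambda>') (stein_map g) \<in> unit_at ` Y' \<longleftrightarrow>
         grange (stein_groupoid \<Gamma> \<Lambda>) g \<in> unit_at ` Y \<and> gsource (stein_groupoid \<Gamma> \<Lambda>) g \<in> unit_at ` Y"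
proof -
  obtain x \<gamma> where g: "g = (x, \<gamma>)" "x \<in> split_line \<Gamma>" "\<gamma> \<in> \<Gamma> \<times> \<Lambda>"
    using assms by (auto simp: dom.stein_groupoid_simps)
  have "inj unit_at" by (rule injI) (simp add: unit_at_def)
  then have "unit_at y \<in> unit_at ` Z \<longleftrightarrow> y \<in> Z" for y Z by (rule inj_image_mem_iff)
  moreover have "split_map h y \<in> Y' \<longleftrightarrow> y \<in> Y" for y
    unfolding Y'[symmetric] using inj_split_map[OF mono] by (rule inj_image_mem_iff)
  ultimately show ?thesis
    using split_map_affine_back[OF g(2,3)] cocycle(1)[OF g(2,3)] g
    by (simp add: stein_map_def dom.stein_groupoid_simps cod.stein_groupoid_simps)
qed

lemma groupoid_hom_reduction:
  "groupoid_hom (reduction (stein_groupoid \<Gamma> \<Lambda>) (unit_at ` Y))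
     (reduction (stein_groupoid \<Gamma>' \<Lambda>') (unit_at ` Y')) stein_map"
  using groupoid_hom_stein_map in_reduction_iff
  unfolding groupoid_hom_def arrows_reduction by (simp add: reduction_def)

lemma continuous_reduction:
  "continuous_map (gtop (reduction (stein_groupoid \<Gamma> \<Lambda>) (unit_at ` Y)))
     (gtop (reduction (stein_groupoid \<Gamma>' \<Lambda>') (unit_at ` Y'))) stein_map"
  using continuous_stein_map groupoid_hom_reduction
  unfolding groupoid_hom_def arrows_reduction
  by (auto simp: reduction_def continuous_map_in_subtopology continuous_map_from_subtopology)

lemma open_reduction:
  "open_map (gtop (reduction (stein_groupoid \<Gamma> \<Lambda>) (unit_at ` Y)))
     (gtop (reduction (stein_groupoid \<Gamma>' \<Lambda>') (unit_at ` Y'))) stein_map"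
  unfolding open_map_def
proof (intro allI impI)
  let ?R = "arrows (reduction (stein_groupoid \<Gamma> \<Lambda>) (unit_at ` Y))"
  let ?R' = "arrows (reduction (stein_groupoid \<Gamma>' \<Lambda>') (unit_at ` Y'))"
  fix U assume "openin (gtop (reduction (stein_groupoid \<Gamma> \<Lambda>) (unit_at ` Y))) U"
  then obtain T where T: "openin (gtop (stein_groupoid \<Gamma> \<Lambda>)) T" "U = T \<inter> ?R"
    by (auto simp: reduction_def openin_subtopology arrows_def)
  then have "T \<subseteq> arrows (stein_groupoid \<Gamma> \<Lambda>)" by (simp add: arrows_def openin_subset)
  then have iff: "stein_map g \<in> ?R' \<longleftrightarrow> g \<in> ?R" if "g \<in> T" for g
  proof -
    have g: "g \<in> arrows (stein_groupoid \<Gamma> \<Lambda>)" using that \<open>T \<subseteq> _\<close> by (rule subsetD[rotated])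
    moreover have "stein_map g \<in> arrows (stein_groupoid \<Gamma>' \<Lambda>')"
      using groupoid_hom_stein_map g by (simp add: groupoid_hom_def)
    ultimately show ?thesis using in_reduction_iff[OF g] by (simp only: arrows_reduction mem_Collect_eq)
  qed
  have "stein_map ` U = stein_map ` T \<inter> ?R'"
    unfolding T(2)
  proof (intro equalityI subsetI)
    fix k assume "k \<in> stein_map ` (T \<inter> ?R)"
    then show "k \<in> stein_map ` T \<inter> ?R'" using iff by (elim imageE IntE) simp
  next
    fix k assume "k \<in> stein_map ` T \<inter> ?R'"
    then show "k \<in> stein_map ` (T \<inter> ?R)" using iff by (elim imageE IntE) simp
  qed
  moreover have "openin (gtop (stein_groupoid \<Gamma>' \<Lambda>')) (stein_map ` T)"
    using open_stein_map T by (simp add: open_map_def)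
  ultimately show "openin (gtop (reduction (stein_groupoid \<Gamma>' \<Lambda>') (unit_at ` Y'))) (stein_map ` U)"
    by (auto simp: reduction_def openin_subtopology arrows_def)
qed

lemma inj_on_reduction:
  "inj_on stein_map (arrows (reduction (stein_groupoid \<Gamma> \<Lambda>) (unit_at ` Y)))"
  using inj_on_stein_map by (rule inj_on_subset) (auto simp: arrows_reduction)

lemma homeomorphic_split_map_subtopology:
  "homeomorphic_map (subtopology (split_space \<Gamma>) Y) (subtopology (split_space \<Gamma>') Y') (split_map h)"
  using homeomorphic_split_map
proof (rule homeomorphic_map_subtopologies)
  show "split_map h ` (topspace (split_space \<Gamma>) \<inter> Y) = topspace (split_space \<Gamma>') \<inter> Y'"
    using Y Y' split_map_image by (auto simp: split_space_def)
qed

end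

end

section \<open>A self-similar homeomorphism of the line\<close>

text \<open>
  \<open>division_point p n k\<close> is the point corresponding to \<open>k/2^n\<close>. An interval between consecutive points
  of stage \<open>n\<close> is cut at stage \<open>Suc n\<close> in the proportion \<open>p : 1 - p\<close>.
\<close>

fun division_point :: "real \<Rightarrow> nat \<Rightarrow> int \<Rightarrow> real" where
  "division_point p 0 k = of_int k"
| "division_point p (Suc n) k =
     (if even k then division_point p n (k div 2)
      else division_point p n (k div 2)
        + p * (division_point p n (k div 2 + 1) - division_point p n (k div 2)))"

text \<open>
  The increasing extension of \<open>k/2^n \<mapsto> division_point p n k\<close>. On \<open>[0,1]\<close> this is the function
  considered by de Rham, the distribution function of a random binary expansion whose digits are
  independent and vanish with probability \<open>p\<close>.
\<close>

definition de_rham :: "real \<Rightarrow> real \<Rightarrow> real" where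
  "de_rham p x = Sup {division_point p n k | n k. real_of_int k \<le> 2 ^ n * x}"

abbreviation mesh :: "real \<Rightarrow> nat \<Rightarrow> int \<Rightarrow> real" where
  "mesh p n k \<equiv> division_point p n (k + 1) - division_point p n k"

lemma mesh_even: "mesh p (Suc n) (2 * k) = p * mesh p n k"
  by simp

lemma mesh_odd: "mesh p (Suc n) (2 * k + 1) = (1 - p) * mesh p n k"
proof -
  have e: "even (2 * k + 1 + 1)" "(2 * k + 1 + 1) div 2 = k + 1" by presburger+
  show ?thesis unfolding division_point.simps e using e by (simp add: algebra_simps)
qed

lemma division_point_refine: "division_point p (n + m) (2 ^ m * k) = division_point p n k"
proof (induction m)
  case (Suc m)
  have e: "2 ^ Suc m * k = 2 * (2 ^ m * k)" by simp
  show ?case unfolding e using Suc by simp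
qed simp

lemma division_point_int: "division_point p n (2 ^ n * k) = of_int k"
  using division_point_refine[of p 0 n k] by simp

text \<open>
  The subdivision of one interval is an affine copy of the subdivision of \<open>[0,1]\<close>, as the same
  proportion is used at every stage. Everything that concerns the conjugated affine maps rests on this.
\<close>

lemma division_point_self_similar:
  assumes "0 \<le> j" "j \<le> 2 ^ m"
  shows "division_point p (n + m) (2 ^ m * k + j)
       = division_point p n k + mesh p n k * division_point p m j"
  using assms
proof (induction m arbitrary: j)
  case 0
  then have "j = 0 \<or> j = 1" by auto
  then show ?case by auto
next
  case (Suc m)
  show ?case
  proof (cases "even j")
    case True
    then obtain i where i: "j = 2 * i" by auto
    have e: "2 ^ Suc m * k + j = 2 * (2 ^ m * k + i)" by (simp add: i)
    show ?thesis unfolding e unfolding i using Suc i by simp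
  next
    case False
    then obtain i where i: "j = 2 * i + 1" by (auto elim: oddE)
    have b: "0 \<le> i" "i + 1 \<le> 2 ^ m" using Suc.prems i by auto
    have e: "2 ^ Suc m * k + j = 2 * (2 ^ m * k + i) + 1" by (simp add: i)
    have IH: "division_point p (n + m) (2 ^ m * k + i)
        = division_point p n k + mesh p n k * division_point p m i"
      "division_point p (n + m) (2 ^ m * k + i + 1)
        = division_point p n k + mesh p n k * division_point p m (i + 1)"
      unfolding add.assoc by (rule Suc.IH; use b in simp)+
    have "division_point p (n + Suc m) (2 ^ Suc m * k + j)
       = division_point p (n + m) (2 ^ m * k + i)
         + p * mesh p (n + m) (2 ^ m * k + i)"
      unfolding e by simp
    also have "\<dots> = division_point p n k
        + mesh p n k * (division_point p m i + p * mesh p m i)"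
      by (simp only: IH) (simp add: algebra_simps)
    also have "division_point p m i + p * mesh p m i = division_point p (Suc m) j"
      by (simp add: i)
    finally show ?thesis .
  qed
qed

locale de_rham_ratio =
  fixes p :: real
  assumes ratio: "0 < p" "p < 1"
begin

lemma mesh_pos: "0 < mesh p n k"
proof (induction n arbitrary: k)
  case (Suc n)
  show ?case
  proof (cases "even k")
    case True
    then obtain i where "k = 2 * i" by auto
    then show ?thesis using mesh_even[of p n i] Suc[of i] ratio by (simp del: division_point.simps)
  next
    case False
    then obtain i where "k = 2 * i + 1" by (auto elim: oddE)
    then show ?thesis using mesh_odd[of p n i] Suc[of i] ratio by (simp del: division_point.simps)
  qed
qed simp

lemma mesh_le: "mesh p n k \<le> max p (1 - p) ^ n"
proof (induction n arbitrary: k)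
  case (Suc n)
  let ?c = "max p (1 - p)"
  have step: "q * mesh p n i \<le> ?c * ?c ^ n" if "q \<le> ?c" for q i
    using that mesh_pos[of n i] Suc[of i] ratio by (intro mult_mono) auto
  show ?case
  proof (cases "even k")
    case True
    then obtain i where "k = 2 * i" by auto
    then show ?thesis using mesh_even[of p n i] step[of p i] by (simp del: division_point.simps)
  next
    case False
    then obtain i where "k = 2 * i + 1" by (auto elim: oddE)
    then show ?thesis using mesh_odd[of p n i] step[of "1 - p" i]
      by (simp del: division_point.simps)
  qed
qed simp

lemma division_point_less: "i < j \<Longrightarrow> division_point p n i < division_point p n j"
proof (induction j rule: int_gr_induct)
  case base
  then show ?case using mesh_pos[of n i] by simp
next
  case (step j)
  then show ?case using mesh_pos[of n j] by simp
qed

text \<open>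
  Fractions with different denominators are compared at a common stage of the subdivision.
\<close>

lemma division_point_less_iff:
  "division_point p n k < division_point p m j \<longleftrightarrow> of_int k / 2 ^ n < (of_int j / 2 ^ m :: real)"
proof -
  have "division_point p n k = division_point p (n + m) (2 ^ m * k)"
    "division_point p m j = division_point p (n + m) (2 ^ n * j)"
    using division_point_refine[of p n m k] division_point_refine[of p m n j]
    by (simp_all add: add.commute)
  moreover have "division_point p (n + m) i < division_point p (n + m) i' \<longleftrightarrow> i < i'" for i i'
    using division_point_less[of i i' "n + m"] division_point_less[of i' i "n + m"]
    by (cases i i' rule: linorder_cases) auto
  moreover have "of_int k / 2 ^ n < (of_int j / 2 ^ m :: real) \<longleftrightarrow>
      real_of_int (2 ^ m * k) < real_of_int (2 ^ n * j)"
    by (simp add: field_simps)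
  ultimately show ?thesis by (simp only: of_int_less_iff)
qed

text \<open>
  The intervals of stage \<open>n\<close> have length at most \<open>max p (1 - p) ^ n\<close>, so once this is less than
  \<open>v - u\<close>, the first division point beyond \<open>u\<close> lies before \<open>v\<close>.
\<close>

lemma division_points_dense:
  assumes "u < v"
  obtains n k where "u < division_point p n k" "division_point p n k < v"
proof -
  have "max p (1 - p) < 1" "0 \<le> max p (1 - p)" using ratio by auto
  then obtain n where n: "max p (1 - p) ^ n < v - u"
    using real_arch_pow_inv[of "v - u" "max p (1 - p)"] assms by auto
  define a where "a = (2::int) ^ n * \<lfloor>u\<rfloor>"
  define Q where "Q i \<longleftrightarrow> u < division_point p n (a + int i)" for i
  have "\<not> Q 0" unfolding Q_def a_def using division_point_int[of p n "\<lfloor>u\<rfloor>"] by simp linarith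
  moreover have "Q (2 ^ n)"
  proof -
    have "a + int (2 ^ n) = 2 ^ n * (\<lfloor>u\<rfloor> + 1)" by (simp add: a_def algebra_simps)
    then show ?thesis unfolding Q_def division_point_int[symmetric]
      by (simp only: division_point_int) linarith
  qed
  ultimately obtain i where i: "\<not> Q i" "Q (Suc i)"
    using ex_least_nat_less[of Q "2 ^ n"] by blast
  have "division_point p n (a + int i + 1) \<le> division_point p n (a + int i) + max p (1 - p) ^ n"
    using mesh_le[of n "a + int i"] by simp
  then show ?thesis
    using that[of n "a + int i + 1"] i n unfolding Q_def by (simp add: algebra_simps)
qed

lemma de_rham_set_bdd: "bdd_above {division_point p n k | n k. real_of_int k \<le> 2 ^ n * x}"
proof (rule bdd_aboveI)
  fix y assume "y \<in> {division_point p n k | n k. real_of_int k \<le> 2 ^ n * x}"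
  then obtain n k where y: "y = division_point p n k" and k: "real_of_int k \<le> 2 ^ n * x" by auto
  have "of_int k / 2 ^ n \<le> x" using k by (simp add: field_simps)
  then have "of_int k / 2 ^ n < (of_int (\<lfloor>x\<rfloor> + 1) / 2 ^ 0 :: real)" by simp linarith
  then show "y \<le> of_int (\<lfloor>x\<rfloor> + 1)"
    using division_point_less_iff[of n k 0 "\<lfloor>x\<rfloor> + 1"] y by simp
qed

lemma de_rham_dyadic: "de_rham p (of_int k / 2 ^ n) = division_point p n k"
  unfolding de_rham_def
proof (rule cSup_eq_maximum)
  show "division_point p n k \<in> {division_point p m j | m j. real_of_int j \<le> 2 ^ m * (of_int k / 2 ^ n)}"
    by (auto intro!: exI[of _ n] exI[of _ k])
next
  fix y assume "y \<in> {division_point p m j | m j. real_of_int j \<le> 2 ^ m * (of_int k / 2 ^ n)}"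
  then obtain m j where y: "y = division_point p m j"
    and j: "of_int j \<le> (2 ^ m * (of_int k / 2 ^ n) :: real)" by auto
  have "\<not> of_int k / 2 ^ n < (of_int j / 2 ^ m :: real)"
    using j by (simp add: field_simps)
  then show "y \<le> division_point p n k"
    using division_point_less_iff[of n k m j] y by simp
qed

lemma de_rham_int: "de_rham p (of_int k) = of_int k"
  using de_rham_dyadic[of k 0] by simp

lemma de_rham_mono: "x \<le> y \<Longrightarrow> de_rham p x \<le> de_rham p y"
  unfolding de_rham_def
proof (rule cSup_subset_mono[OF _ de_rham_set_bdd])
  have "division_point p 0 \<lfloor>x\<rfloor> \<in> {division_point p n k | n k. real_of_int k \<le> 2 ^ n * x}"
    by (auto intro!: exI[of _ "0::nat"] exI[of _ "\<lfloor>x\<rfloor>"])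
  then show "{division_point p n k | n k. real_of_int k \<le> 2 ^ n * x} \<noteq> {}" by blast
  assume "x \<le> y"
  then have "2 ^ n * x \<le> 2 ^ n * y" for n by simp
  then show "{division_point p n k | n k. real_of_int k \<le> 2 ^ n * x}
      \<subseteq> {division_point p n k | n k. real_of_int k \<le> 2 ^ n * y}"
    using order_trans by fast
qed

lemma strict_mono_de_rham: "strict_mono (de_rham p)"
proof (rule strict_monoI)
  fix x y :: real assume "x < y"
  then obtain n where n: "(1 / 2) ^ n < (y - x) / 2"
    using real_arch_pow_inv[of "(y - x) / 2" "1 / 2"] by auto
  define k where "k = \<lfloor>2 ^ n * x\<rfloor> + 1"
  have "2 ^ n * x < of_int k" unfolding k_def by linarith
  then have 1: "x \<le> of_int k / 2 ^ n" by (simp add: field_simps)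
  have "of_int (k + 1) \<le> 2 ^ n * x + 2" unfolding k_def by linarith
  also have "\<dots> \<le> 2 ^ n * y" using n by (simp add: field_simps power_one_over)
  finally have 2: "of_int (k + 1) / 2 ^ n \<le> y" by (simp add: field_simps)
  have "de_rham p x \<le> division_point p n k" using de_rham_mono[OF 1] de_rham_dyadic by simp
  also have "\<dots> < division_point p n (k + 1)" by (rule division_point_less) simp
  also have "\<dots> \<le> de_rham p y" using de_rham_mono[OF 2] de_rham_dyadic[of "k + 1" n] by simp
  finally show "de_rham p x < de_rham p y" .
qed

lemma de_rham_less_iff: "de_rham p x < de_rham p y \<longleftrightarrow> x < y"
  using strict_mono_de_rham by (rule strict_mono_less)

text \<open>
  An increasing function whose values on the dyadic numbers are dense cannot skip a value: the
  supremum of the dyadic numbers with value at most \<open>y\<close> is mapped to \<open>y\<close>.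
\<close>

lemma surj_de_rham: "surj (de_rham p)"
proof -
  have "\<exists>x. de_rham p x = y" for y
  proof -
  define B where "B = {of_int k / 2 ^ n :: real | k n. division_point p n k \<le> y}"
  have bdd: "bdd_above B"
  proof (rule bdd_aboveI)
    fix x assume "x \<in> B"
    then obtain n k where x: "x = of_int k / 2 ^ n" "division_point p n k \<le> y"
      unfolding B_def by auto
    then have "de_rham p x < de_rham p (of_int (\<lfloor>y\<rfloor> + 1))"
      unfolding de_rham_int x(1) de_rham_dyadic by linarith
    then show "x \<le> of_int (\<lfloor>y\<rfloor> + 1)" unfolding de_rham_less_iff by simp
  qed
  have "of_int \<lfloor>y\<rfloor> / 2 ^ 0 \<in> B" unfolding B_def by (force intro!: exI[of _ "\<lfloor>y\<rfloor>"] exI[of _ "0::nat"])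
  then have ne: "B \<noteq> {}" by blast
  have "\<not> de_rham p (Sup B) < y"
  proof
    assume "de_rham p (Sup B) < y"
    then obtain n k where d: "de_rham p (Sup B) < division_point p n k" "division_point p n k < y"
      by (rule division_points_dense)
    have "of_int k / 2 ^ n \<in> B"
      unfolding B_def using d(2) by (intro CollectI exI[of _ k] exI[of _ n]) simp
    then have "of_int k / 2 ^ n \<le> Sup B" using bdd by (rule cSup_upper)
    then show False using de_rham_mono[of "of_int k / 2 ^ n" "Sup B"] d by (simp add: de_rham_dyadic)
  qed
  moreover have "\<not> y < de_rham p (Sup B)"
  proof
    assume "y < de_rham p (Sup B)"
    then obtain n k where d: "y < division_point p n k" "division_point p n k < de_rham p (Sup B)"
      by (rule division_points_dense)
    then have "of_int k / 2 ^ n < Sup B" by (simp only: de_rham_less_iff flip: de_rham_dyadic)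
    then obtain x where x: "x \<in> B" "of_int k / 2 ^ n < x" using less_cSupE[OF _ ne] by blast
    then show False using d de_rham_less_iff[of "of_int k / 2 ^ n" x]
      unfolding B_def by (auto simp: de_rham_dyadic)
  qed
  ultimately show ?thesis by (metis linorder_neqE)
  qed
  then show ?thesis by (metis surjI)
qed

lemma continuous_de_rham: "isCont (de_rham p) x"
  using strict_mono_de_rham surj_de_rham by (rule isCont_strict_mono_surj)

text \<open>
  Both sides are continuous in \<open>w\<close>, and for dyadic \<open>w\<close> the identity is the self-similarity of the
  division points.
\<close>

lemma de_rham_self_similar:
  assumes "0 \<le> w" "w \<le> 1"
  shows "de_rham p ((of_int k + w) / 2 ^ n) = division_point p n k + mesh p n k * de_rham p w"
proof -
  define d where "d m = real_of_int \<lfloor>2 ^ m * w\<rfloor> / 2 ^ m" for m :: nat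
  have lim: "d \<longlonglongrightarrow> w"
  proof (rule LIMSEQ_I)
    fix r :: real assume "0 < r"
    then obtain N where N: "(1 / 2) ^ N < r" using real_arch_pow_inv[of r "1 / 2"] by auto
    have "norm (d m - w) < r" if "N \<le> m" for m
    proof -
      have "2 ^ m * w - 1 < of_int \<lfloor>2 ^ m * w\<rfloor>" "of_int \<lfloor>2 ^ m * w\<rfloor> \<le> 2 ^ m * w" by linarith+
      then have "(w - d m) * 2 ^ m \<le> 1" "d m * 2 ^ m \<le> w * 2 ^ m"
        unfolding d_def by (simp_all add: left_diff_distrib mult.commute[of w]) linarith
      then have "w - d m \<le> (1 / 2) ^ m" "d m \<le> w"
        by (simp_all add: power_one_over pos_le_divide_eq)
      moreover have "(1 / 2 :: real) ^ m \<le> (1 / 2) ^ N" using that by (simp add: power_decreasing)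
      ultimately have "w - d m < r" "0 \<le> w - d m" using N by linarith+
      then show ?thesis by simp
    qed
    then show "\<exists>N. \<forall>m\<ge>N. norm (d m - w) < r" by blast
  qed
  have eq: "de_rham p ((of_int k + d m) / 2 ^ n) = division_point p n k + mesh p n k * de_rham p (d m)"
    for m
  proof -
    define j where "j = \<lfloor>2 ^ m * w\<rfloor>"
    have "0 \<le> j" unfolding j_def using assms by simp
    have "2 ^ m * w \<le> 2 ^ m" using assms by (simp add: mult_left_le)
    moreover have "real_of_int j \<le> 2 ^ m * w" unfolding j_def by linarith
    ultimately have "real_of_int j \<le> 2 ^ m" by linarith
    then have "j \<le> 2 ^ m" by simp
    have dj: "d m = of_int j / 2 ^ m" by (simp add: d_def j_def)
    have "(of_int k + d m) / 2 ^ n = of_int (2 ^ m * k + j) / 2 ^ (n + m)"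
      unfolding dj by (simp add: field_simps power_add)
    then show ?thesis
      using division_point_self_similar[OF \<open>0 \<le> j\<close> \<open>j \<le> 2 ^ m\<close>, of p n k]
      by (simp only: dj de_rham_dyadic)
  qed
  have "(\<lambda>m. de_rham p ((of_int k + d m) / 2 ^ n)) \<longlonglongrightarrow> de_rham p ((of_int k + w) / 2 ^ n)"
    by (rule isCont_tendsto_compose[OF continuous_de_rham]) (intro tendsto_intros lim, simp)
  moreover have "(\<lambda>m. division_point p n k + mesh p n k * de_rham p (d m))
      \<longlonglongrightarrow> division_point p n k + mesh p n k * de_rham p w"
    by (intro tendsto_intros isCont_tendsto_compose[OF continuous_de_rham] lim)
  ultimately show ?thesis unfolding eq by (rule LIMSEQ_unique)
qed

end

section \<open>Rings of Laurent polynomials in a real number\<close>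

lemma laurent_ring_monomial: "of_int c * l powi k \<in> laurent_ring l"
  unfolding laurent_ring_def by (intro CollectI exI[of _ "\<lambda>_. c"] exI[of _ "{k}"]) simp

lemma laurent_ring_int: "of_int c \<in> laurent_ring l"
  using laurent_ring_monomial[of c l 0] by simp

lemma laurent_ring_add:
  assumes "x \<in> laurent_ring l" "y \<in> laurent_ring l"
  shows "x + y \<in> laurent_ring l"
proof -
  obtain c K where x: "x = (\<Sum>k\<in>K. of_int (c k) * l powi k)" "finite K"
    using assms(1) unfolding laurent_ring_def by blast
  obtain d J where y: "y = (\<Sum>k\<in>J. of_int (d k) * l powi k)" "finite J"
    using assms(2) unfolding laurent_ring_def by blast
  let ?e = "\<lambda>k. (if k \<in> K then c k else 0) + (if k \<in> J then d k else 0)"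
  have "x = (\<Sum>k\<in>K \<union> J. of_int (if k \<in> K then c k else 0) * l powi k)"
    unfolding x(1) by (rule sum.mono_neutral_cong_left) (use x y in auto)
  moreover have "y = (\<Sum>k\<in>K \<union> J. of_int (if k \<in> J then d k else 0) * l powi k)"
    unfolding y(1) by (rule sum.mono_neutral_cong_left) (use x y in auto)
  ultimately have "x + y = (\<Sum>k\<in>K \<union> J. of_int (?e k) * l powi k)"
    by (simp add: distrib_right flip: sum.distrib)
  then show ?thesis unfolding laurent_ring_def using x(2) y(2)
    by (intro CollectI exI[of _ ?e] exI[of _ "K \<union> J"] conjI) simp_all
qed

text \<open>
  Finite sums of monomials are handled through closure under addition, which avoids computing with
  coefficient families.
\<close>

lemma laurent_ring_induct [consumes 1, case_names zero add monomial]: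
  assumes "x \<in> laurent_ring l" "P 0" "\<And>x y. P x \<Longrightarrow> P y \<Longrightarrow> P (x + y)"
    "\<And>c k. P (of_int c * l powi k)"
  shows "P x"
proof -
  obtain c K where x: "x = (\<Sum>k\<in>K. of_int (c k) * l powi k)" "finite K"
    using assms(1) unfolding laurent_ring_def by blast
  show ?thesis unfolding x(1) using x(2) by (induction K) (simp_all add: assms)
qed

lemma laurent_ring_uminus: "x \<in> laurent_ring l \<Longrightarrow> - x \<in> laurent_ring l"
proof (induction rule: laurent_ring_induct)
  case (add x y)
  then show ?case using laurent_ring_add[of "- x" l "- y"] by simp
next
  case (monomial c k)
  show ?case using laurent_ring_monomial[of "- c" l k] by simp
qed (use laurent_ring_int[of 0] in simp)

lemma laurent_ring_scale:
  assumes "l \<noteq> 0" "x \<in> laurent_ring l"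
  shows "l powi j * x \<in> laurent_ring l"
  using assms(2)
proof (induction rule: laurent_ring_induct)
  case (add x y)
  then show ?case using laurent_ring_add[of "l powi j * x" l "l powi j * y"]
    by (simp add: distrib_left)
next
  case (monomial c k)
  show ?case using laurent_ring_monomial[of c l "j + k"] assms(1)
    by (simp add: power_int_add mult_ac)
qed (use laurent_ring_int[of 0] in simp)

lemma affine_data_laurent:
  assumes "0 < l"
  shows "affine_data (laurent_ring l) (int_powers l)"
proof
  show "0 \<in> laurent_ring l" using laurent_ring_int[of 0] by simp
  show "1 \<in> int_powers l" unfolding int_powers_def by (intro range_eqI[of _ _ 0]) simp
  show "x * y \<in> int_powers l" if "x \<in> int_powers l" "y \<in> int_powers l" for x y
    using that assms unfolding int_powers_def by (auto simp flip: power_int_add)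
  show "inverse x \<in> int_powers l" if "x \<in> int_powers l" for x
    using that unfolding int_powers_def by (auto simp flip: power_int_minus)
  show "0 < x" if "x \<in> int_powers l" for x
    using that assms unfolding int_powers_def by auto
  show "x * y \<in> laurent_ring l" if "x \<in> int_powers l" "y \<in> laurent_ring l" for x y
    using that assms laurent_ring_scale unfolding int_powers_def by auto
qed (simp_all add: laurent_ring_add laurent_ring_uminus)

lemma laurent_ring_2: "laurent_ring 2 = {of_int k / 2 ^ n | k n. True}"
proof (intro equalityI subsetI)
  fix x :: real assume "x \<in> laurent_ring 2"
  then show "x \<in> {of_int k / 2 ^ n | k n. True}"
  proof (induction rule: laurent_ring_induct)
    case zero
    show ?case by (auto intro!: exI[of _ "0::int"])
  next
    case (add x y)
    then obtain k n j m where "x = of_int k / 2 ^ n" "y = of_int j / 2 ^ m" by auto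
    then have "x + y = of_int (k * 2 ^ m + j * 2 ^ n) / 2 ^ (n + m)"
      by (simp add: power_add add_divide_distrib)
    then show ?case by blast
  next
    case (monomial c k)
    show ?case
    proof (cases "0 \<le> k")
      case True
      then have "of_int c * 2 powi k = (of_int (c * 2 ^ nat k) / 2 ^ 0 :: real)"
        by (simp add: power_int_def)
      then show ?thesis by blast
    next
      case False
      then have "of_int c * 2 powi k = (of_int c / 2 ^ nat (- k) :: real)"
        by (simp add: power_int_def field_simps)
      then show ?thesis by blast
    qed
  qed
next
  fix x :: real assume "x \<in> {of_int k / 2 ^ n | k n. True}"
  then obtain k n where "x = of_int k / 2 ^ n" by auto
  then show "x \<in> laurent_ring 2"
    using laurent_ring_monomial[of k 2 "- int n"] by (simp add: power_int_minus divide_inverse)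
qed

section \<open>Subdivision at the golden mean\<close>

text \<open>
  Every side of every point is covered by a dyadic interval at all sufficiently fine stages: a
  dyadic number is itself an end point from some stage on, and other numbers are always interior.
\<close>

lemma side_filter_dyadic_interval:
  assumes "x \<in> split_line (laurent_ring 2)"
  obtains M where "\<And>N. M \<le> N \<Longrightarrow> \<exists>k::int.
    eventually (\<lambda>z. of_int k \<le> 2 ^ N * z \<and> 2 ^ N * z \<le> of_int k + 1) (side_filter x)"
proof -
  have inside: "eventually (\<lambda>z. of_int k \<le> 2 ^ N * z \<and> 2 ^ N * z \<le> of_int k + 1) F"
    if "eventually (\<lambda>z. of_int k / 2 ^ N < z \<and> z < (of_int k + 1) / 2 ^ N) F"
    for N and k :: int and F :: "real filter"
    using that by eventually_elim (simp add: field_simps)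
  show ?thesis
  proof (cases x)
    case (Pt t)
    then have t: "t \<notin> laurent_ring 2" using assms by (simp add: split_line_points)
    have "\<exists>k::int. eventually (\<lambda>z. of_int k \<le> 2 ^ N * z \<and> 2 ^ N * z \<le> of_int k + 1) (side_filter x)" for N
    proof -
      define k where "k = \<lfloor>2 ^ N * t\<rfloor>"
      have "t \<noteq> of_int k / 2 ^ N" using t laurent_ring_2 by blast
      then have "of_int k \<noteq> 2 ^ N * t" by (auto simp: field_simps)
      then have "of_int k < 2 ^ N * t" "2 ^ N * t < of_int k + 1" unfolding k_def by linarith+
      then have "of_int k / 2 ^ N < t" "t < (of_int k + 1) / 2 ^ N" by (simp_all add: field_simps)
      then show ?thesis
        using inside[OF eventually_side_filter_inside[where x = x]] Pt by fastforce
    qed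
    then show ?thesis using that by blast
  next
    case (Minus t)
    then have "t \<in> laurent_ring 2" using assms by (simp add: split_line_points)
    then obtain i n where t: "t = of_int i / 2 ^ n" using laurent_ring_2 by auto
    have "\<exists>k::int. eventually (\<lambda>z. of_int k \<le> 2 ^ N * z \<and> 2 ^ N * z \<le> of_int k + 1) (side_filter x)"
      if "n \<le> N" for N
    proof -
      have teq: "t = (of_int (i * 2 ^ (N - n) - 1) + 1) / 2 ^ N"
        using that by (simp add: t field_simps flip: power_add)
      moreover have "(of_int (i * 2 ^ (N - n) - 1)) / 2 ^ N < (of_int (i * 2 ^ (N - n) - 1) + 1) / (2 ^ N :: real)"
        by (simp add: divide_strict_right_mono)
      ultimately have "of_int (i * 2 ^ (N - n) - 1) / 2 ^ N < t" by simp
      then have "eventually (\<lambda>z. of_int (i * 2 ^ (N - n) - 1) / 2 ^ N < z \<and> z < t) (at_left t)"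
        by (auto simp: eventually_at_left_field)
      then have "eventually (\<lambda>z. of_int (i * 2 ^ (N - n) - 1) / 2 ^ N < z \<and> z < (of_int (i * 2 ^ (N - n) - 1) + 1) / 2 ^ N) (side_filter x)"
        using teq Minus by simp
      then show ?thesis by (intro exI[of _ "(i * 2 ^ (N - n) - 1)"]) (rule inside)
    qed
    then show ?thesis using that by blast
  next
    case (Plus t)
    then have "t \<in> laurent_ring 2" using assms by (simp add: split_line_points)
    then obtain i n where t: "t = of_int i / 2 ^ n" using laurent_ring_2 by auto
    have "\<exists>k::int. eventually (\<lambda>z. of_int k \<le> 2 ^ N * z \<and> 2 ^ N * z \<le> of_int k + 1) (side_filter x)"
      if "n \<le> N" for N
    proof -
      have teq: "t = of_int (i * 2 ^ (N - n)) / 2 ^ N"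
        using that by (simp add: t field_simps flip: power_add)
      moreover have "of_int (i * 2 ^ (N - n)) / 2 ^ N < (of_int (i * 2 ^ (N - n)) + 1) / (2 ^ N :: real)"
        by (simp add: divide_strict_right_mono)
      ultimately have "t < (of_int (i * 2 ^ (N - n)) + 1) / 2 ^ N" by simp
      then have "eventually (\<lambda>z. t < z \<and> z < (of_int (i * 2 ^ (N - n)) + 1) / 2 ^ N) (at_right t)"
        by (auto simp: eventually_at_right_field)
      then have "eventually (\<lambda>z. of_int (i * 2 ^ (N - n)) / 2 ^ N < z \<and> z < (of_int (i * 2 ^ (N - n)) + 1) / 2 ^ N) (side_filter x)"
        using teq Plus by simp
      then show ?thesis by (intro exI[of _ "(i * 2 ^ (N - n))"]) (rule inside)
    qed
    then show ?thesis using that by blast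
  qed
qed

text \<open>
  The ratio \<open>p = \<beta> - 1\<close> is \<open>1/\<beta>\<close> by the equation \<open>\<beta>\<^sup>2 = \<beta> + 1\<close>.
\<close>

locale golden_mean =
  fixes \<beta> p :: real
  assumes \<beta>: "\<beta> = (sqrt 5 + 1) / 2" and p: "p = \<beta> - 1"
begin

lemma golden: "\<beta> * \<beta> = \<beta> + 1" "3 / 2 < \<beta>" "\<beta> < 2"
proof -
  have "sqrt 5 * sqrt 5 = (5::real)" by simp
  then show "\<beta> * \<beta> = \<beta> + 1" unfolding \<beta> by (simp add: field_simps)
  have "2 < sqrt (5::real)" by (rule real_less_rsqrt) simp
  then show "3 / 2 < \<beta>" unfolding \<beta> by simp
  have "sqrt (5::real) < 3" by (rule real_less_lsqrt) simp_all
  then show "\<beta> < 2" unfolding \<beta> by simp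
qed

lemma p_rules: "p * p = 1 - p" "\<beta> * p = 1" "inverse \<beta> = p" "p = \<beta> powi (- 1)"
proof -
  show "p * p = 1 - p" unfolding p using golden(1) by (simp add: algebra_simps)
  show "\<beta> * p = 1" unfolding p using golden(1) by (simp add: algebra_simps)
  then show "inverse \<beta> = p" by (rule inverse_unique)
  then show "p = \<beta> powi (- 1)" by (simp add: power_int_minus)
qed

sublocale de_rham_ratio p
  by unfold_locales (use golden p in simp_all)

lemma mesh_power: "\<exists>m. mesh p n k = p ^ m"
proof (induction n arbitrary: k)
  case 0
  show ?case by (intro exI[of _ 0]) simp
next
  case (Suc n)
  show ?case
  proof (cases "even k")
    case True
    then obtain i where i: "k = 2 * i" by auto
    obtain m where "mesh p n i = p ^ m" using Suc by blast
    then have "mesh p (Suc n) k = p ^ Suc m" using mesh_even[of p n i] unfolding i by simp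
    then show ?thesis by blast
  next
    case False
    then obtain i where i: "k = 2 * i + 1" by (auto elim: oddE)
    obtain m where "mesh p n i = p ^ m" using Suc by blast
    then have "mesh p (Suc n) k = p ^ Suc (Suc m)"
      using mesh_odd[of p n i] p_rules(1) unfolding i by (simp flip: mult.assoc)
    then show ?thesis by blast
  qed
qed

text \<open>
  Since \<open>1 - p = p\<^sup>2\<close>, both parts of a subdivided interval have a power of \<open>\<beta>\<close> as length if the whole
  does. This relation is the reason for the golden mean.
\<close>

lemma mesh_int_powers: "mesh p n k \<in> int_powers \<beta>"
proof -
  obtain m where "mesh p n k = p ^ m" using mesh_power by blast
  also have "\<dots> = \<beta> powi (- int m)"
    by (simp add: power_int_minus power_inverse flip: p_rules(3))
  finally show ?thesis unfolding int_powers_def by blast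
qed

lemma division_point_in_ring: "division_point p n k \<in> laurent_ring \<beta>"
proof (induction n arbitrary: k)
  case 0
  show ?case using laurent_ring_int by simp
next
  case (Suc n)
  have "\<beta> \<noteq> 0" using golden by simp
  have "x + p * (y - x) \<in> laurent_ring \<beta>" if "x \<in> laurent_ring \<beta>" "y \<in> laurent_ring \<beta>" for x y
  proof -
    have "\<beta> powi (- 1) * (y + - x) \<in> laurent_ring \<beta>"
      by (intro laurent_ring_scale laurent_ring_add laurent_ring_uminus that \<open>\<beta> \<noteq> 0\<close>)
    then have "p * (y - x) \<in> laurent_ring \<beta>" unfolding p_rules(4)[symmetric] by simp
    then show ?thesis by (rule laurent_ring_add[OF that(1)])
  qed
  then show ?case using Suc by simp
qed

lemma ring_eq: 
  assumes "x \<in> laurent_ring \<beta>"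
  obtains a b :: int where "x = of_int a + of_int b * \<beta>"
proof -
  have up: "\<exists>a b :: int. \<beta> ^ n = of_int a + of_int b * \<beta>" for n
  proof (induction n)
    case 0
    show ?case by (intro exI[of _ 1] exI[of _ 0]) simp
  next
    case (Suc n)
    then obtain a b :: int where "\<beta> ^ n = of_int a + of_int b * \<beta>" by blast
    then have "\<beta> ^ Suc n = of_int a * \<beta> + of_int b * (\<beta> * \<beta>)" by (simp add: algebra_simps)
    then have "\<beta> ^ Suc n = of_int b + of_int (a + b) * \<beta>"
      unfolding golden by (simp add: algebra_simps)
    then show ?case by blast
  qed
  have down: "\<exists>a b :: int. inverse \<beta> ^ n = of_int a + of_int b * \<beta>" for n
  proof (induction n)
    case 0
    show ?case by (intro exI[of _ 1] exI[of _ 0]) simp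
  next
    case (Suc n)
    then obtain a b :: int where "inverse \<beta> ^ n = of_int a + of_int b * \<beta>" by blast
    then have "inverse \<beta> ^ Suc n = of_int a * (\<beta> - 1) + of_int b * (\<beta> * p)"
      by (simp add: p_rules(3) p algebra_simps)
    then have "inverse \<beta> ^ Suc n = of_int (b - a) + of_int a * \<beta>"
      unfolding p_rules(2) by (simp add: algebra_simps)
    then show ?case by blast
  qed
  have "\<exists>a b :: int. x = of_int a + of_int b * \<beta>"
    using assms
  proof (induction rule: laurent_ring_induct)
    case zero
    show ?case by (intro exI[of _ 0]) simp
  next
    case (add x y)
    then obtain a b c d :: int where "x = of_int a + of_int b * \<beta>" "y = of_int c + of_int d * \<beta>"
      by blast
    then have "x + y = of_int (a + c) + of_int (b + d) * \<beta>" by (simp add: algebra_simps)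
    then show ?case by blast
  next
    case (monomial c k)
    obtain a b :: int where "\<beta> powi k = of_int a + of_int b * \<beta>"
      using up down unfolding power_int_def by metis
    then have "of_int c * \<beta> powi k = of_int (c * a) + of_int (c * b) * \<beta>"
      by (simp add: algebra_simps)
    then show ?case by blast
  qed
  then show ?thesis using that by blast
qed

text \<open>
  Here \<open>y'\<close> is the Galois conjugate of \<open>y\<close>. If \<open>y < p\<close>, then \<open>y\<close> lies in the first part of \<open>[0,1]\<close> and
  is a division point as soon as \<open>\<beta> y\<close> is one; otherwise it lies in the second part, and the same holds
  for \<open>\<beta>\<^sup>2 (y - p)\<close>. The conjugate is mapped to \<open>- p y'\<close> and to \<open>p\<^sup>2 y' + p\<close> respectively. Both maps send
  the interval \<open>[-p, 1]\<close> into itself and multiply distances to it by at most \<open>p = 1/\<beta>\<close>, whence the exponent \<open>N\<close> drops by one at each step. At \<open>N = 0\<close> the excess \<open>1/2\<close> is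
  small enough to force \<open>b = 0\<close>.
\<close>

lemma greedy_expansion_finite:
  fixes a b :: int
  defines "y \<equiv> of_int a + of_int b * \<beta>" and "y' \<equiv> of_int a + of_int b * (1 - \<beta>)"
  assumes "0 \<le> y" "y < 1" "- p - \<beta> ^ N / 2 \<le> y'" "y' \<le> 1 + \<beta> ^ N / 2"
  shows "\<exists>n j. 0 \<le> j \<and> j \<le> 2 ^ n \<and> division_point p n j = y"
  using assms(3-) unfolding y_def y'_def
proof (induction N arbitrary: a b)
  case 0
  \<comment> \<open>\<open>2 * \<beta> - 1\<close> is \<open>sqrt 5\<close>, and \<open>b * sqrt 5\<close> is the difference between \<open>y\<close> and its conjugate; it is at
    least \<open>- 3/2\<close> and less than \<open>\<beta> + 1/2\<close>.\<close>
  have "of_int b * (2 * \<beta> - 1) < 1 * (2 * \<beta> - 1)" "(- 1) * (2 * \<beta> - 1) < of_int b * (2 * \<beta> - 1)"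
    using 0 golden(2) p by (simp_all add: algebra_simps)
  then have "real_of_int b < 1" "- 1 < real_of_int b"
    using golden(2) by (simp_all only: mult_less_cancel_right)
  then have "b = 0" by linarith
  then have "a = 0" using 0 by simp
  then show ?case using \<open>b = 0\<close> by (intro exI[of _ 0]) simp
next
  case (Suc N)
  let ?y = "of_int a + of_int b * \<beta>" and ?y' = "of_int a + of_int b * (1 - \<beta>)"
  have square: "\<beta> * (\<beta> * c) = c + \<beta> * c" for c
    by (simp add: golden(1) distrib_right flip: mult.assoc)
  have p0: "0 < p" by (rule ratio)
  have pS: "p * \<beta> ^ Suc N = \<beta> ^ N" using p_rules(2) by (simp add: mult.commute flip: mult.assoc)
  have conj_lo: "p * (- p - \<beta> ^ Suc N / 2) \<le> p * ?y'" and conj_hi: "p * ?y' \<le> p * (1 + \<beta> ^ Suc N / 2)"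
    using Suc.prems(3,4) p0 by (simp_all only: mult_le_cancel_left_pos)
  have expand_lo: "p * (- q - c / 2) = - (p * q) - p * c / 2"
    and expand_hi: "p * (q + c / 2) = p * q + p * c / 2" for q c
    by (simp_all add: algebra_simps)
  have lo: "- (1 - p) - \<beta> ^ N / 2 \<le> p * ?y'" and hi: "p * ?y' \<le> p + \<beta> ^ N / 2"
    using conj_lo conj_hi unfolding expand_lo expand_hi pS p_rules(1) by simp_all
  have bN: "0 \<le> \<beta> ^ N" using golden by simp
  show ?case
  proof (cases "?y < p")
    case True
    have "of_int b + of_int (a + b) * \<beta> = of_int a * \<beta> + of_int b * (\<beta> + 1)"
      by (simp add: algebra_simps)
    also have "\<dots> = \<beta> * ?y" unfolding golden(1)[symmetric] by (simp add: algebra_simps)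
    finally have z: "of_int b + of_int (a + b) * \<beta> = \<beta> * ?y" .
    have "of_int b + of_int (a + b) * (1 - \<beta>) = - of_int a * p + of_int b * (1 - p)"
      unfolding p by (simp add: algebra_simps)
    also have "\<dots> = - (p * ?y')" unfolding p_rules(1)[symmetric] by (simp add: p algebra_simps)
    finally have z': "of_int b + of_int (a + b) * (1 - \<beta>) = - (p * ?y')" .
    \<comment> \<open>The expanding map replaces \<open>y\<close> by \<open>\<beta> y\<close>.\<close>
    have "\<exists>n j. 0 \<le> j \<and> j \<le> 2 ^ n \<and>
        division_point p n j = of_int b + of_int (a + b) * \<beta>"
    proof (rule Suc.IH)
      show "0 \<le> of_int b + of_int (a + b) * \<beta>" unfolding z using Suc.prems golden by simp
      have "\<beta> * ?y < \<beta> * p" using True golden by (intro mult_strict_left_mono) auto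
      then show "of_int b + of_int (a + b) * \<beta> < 1" unfolding z p_rules(2) .
      show "- p - \<beta> ^ N / 2 \<le> of_int b + of_int (a + b) * (1 - \<beta>)"
        unfolding z' using hi by simp
      show "of_int b + of_int (a + b) * (1 - \<beta>) \<le> 1 + \<beta> ^ N / 2"
        unfolding z' using lo p0 by linarith
    qed
    then obtain n j where j: "0 \<le> j" "j \<le> 2 ^ n" "division_point p n j = \<beta> * ?y"
      unfolding z by blast
    have "division_point p (1 + n) (2 ^ n * 0 + j) = p * (\<beta> * ?y)"
      using division_point_self_similar[OF j(1,2), of p 1 0] j(3) by simp
    also have "\<dots> = ?y" using p_rules(2) by (simp add: mult.commute[of p] flip: mult.assoc)
    finally have "division_point p (Suc n) j = ?y" by simp
    then show ?thesis using j by (intro exI[of _ "Suc n"] exI[of _ j]) auto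
  next
    case False
    have "of_int (a + b) + of_int (a + 2 * b - 1) * \<beta>
        = of_int a * (\<beta> + 1) + of_int b * (\<beta> + (\<beta> + 1)) - \<beta>"
      by (simp add: algebra_simps)
    also have "\<dots> = (\<beta> + 1) * (?y - p)"
      using golden(1) unfolding p by (simp add: square algebra_simps)
    finally have z: "of_int (a + b) + of_int (a + 2 * b - 1) * \<beta> = (\<beta> + 1) * (?y - p)" .
    have z': "of_int (a + b) + of_int (a + 2 * b - 1) * (1 - \<beta>) = p * (p * ?y') + p"
      using golden(1) unfolding p by (simp add: square algebra_simps)
    have lo2: "p * (- (1 - p) - \<beta> ^ N / 2) \<le> p * (p * ?y')" and hi2: "p * (p * ?y') \<le> p * (p + \<beta> ^ N / 2)"
      using lo hi p0 by (simp_all only: mult_le_cancel_left_pos)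
    have "p * (1 - p) = p - (1 - p)" by (simp add: right_diff_distrib p_rules(1))
    then have lo3: "- (p - (1 - p)) - p * \<beta> ^ N / 2 \<le> p * (p * ?y')"
      and hi3: "p * (p * ?y') \<le> (1 - p) + p * \<beta> ^ N / 2"
      using lo2 hi2 unfolding expand_lo expand_hi p_rules(1) by simp_all
    have pN: "p * \<beta> ^ N \<le> \<beta> ^ N" using ratio bN by (simp add: mult_left_le_one_le)
    \<comment> \<open>The expanding map replaces \<open>y\<close> by \<open>\<beta>\<^sup>2 (y - p)\<close>, where \<open>\<beta>\<^sup>2 = \<beta> + 1\<close>.\<close>
    have "\<exists>n j. 0 \<le> j \<and> j \<le> 2 ^ n \<and>
        division_point p n j = of_int (a + b) + of_int (a + 2 * b - 1) * \<beta>"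
    proof (rule Suc.IH)
      show "0 \<le> of_int (a + b) + of_int (a + 2 * b - 1) * \<beta>"
        unfolding z using False golden by simp
      have "(\<beta> + 1) * (?y - p) < (\<beta> + 1) * (1 - p)"
        using Suc.prems golden by (intro mult_strict_left_mono) auto
      also have "\<dots> = 1" using golden(1) unfolding p by (simp add: algebra_simps)
      finally show "of_int (a + b) + of_int (a + 2 * b - 1) * \<beta> < 1" unfolding z .
      show "- p - \<beta> ^ N / 2 \<le> of_int (a + b) + of_int (a + 2 * b - 1) * (1 - \<beta>)"
        unfolding z' using lo3 pN ratio by linarith
      show "of_int (a + b) + of_int (a + 2 * b - 1) * (1 - \<beta>) \<le> 1 + \<beta> ^ N / 2"
        unfolding z' using hi3 pN by linarith
    qed
    then obtain n j where j: "0 \<le> j" "j \<le> 2 ^ n" "division_point p n j = (\<beta> + 1) * (?y - p)"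
      unfolding z by blast
    have "division_point p (1 + n) (2 ^ n * 1 + j) = p + (1 - p) * ((\<beta> + 1) * (?y - p))"
      using division_point_self_similar[OF j(1,2), of p 1 1] j(3) by simp
    also have "(1 - p) * ((\<beta> + 1) * (?y - p)) = ((1 - p) * (\<beta> + 1)) * (?y - p)" by simp
    also have "(1 - p) * (\<beta> + 1) = 1" using golden(1) unfolding p by (simp add: algebra_simps)
    finally have "division_point p (Suc n) (2 ^ n + j) = ?y" by simp
    then show ?thesis using j by (intro exI[of _ "Suc n"] exI[of _ "2 ^ n + j"]) auto
  qed
qed

text \<open>
  The integer part accounts for the translate of \<open>[0,1]\<close>; the fractional part is a division point of
  \<open>[0,1]\<close> by the finiteness of its expansion.
\<close>

lemma ring_division_point:
  assumes "y \<in> laurent_ring \<beta>"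
  obtains n k where "division_point p n k = y"
proof -
  obtain a0 b :: int where y: "y = of_int a0 + of_int b * \<beta>" using assms by (rule ring_eq)
  define a where "a = a0 - \<lfloor>y\<rfloor>"
  define y' where "y' = of_int a + of_int b * (1 - \<beta>)"
  have frac: "of_int a + of_int b * \<beta> = y - of_int \<lfloor>y\<rfloor>" unfolding a_def by (simp add: y)
  have "1 < \<beta>" using golden by simp
  then obtain N where "2 * \<bar>y'\<bar> < \<beta> ^ N" using real_arch_pow by blast
  then have "- p - \<beta> ^ N / 2 \<le> y'" "y' \<le> 1 + \<beta> ^ N / 2" using ratio by linarith+
  moreover have "0 \<le> of_int a + of_int b * \<beta>" "of_int a + of_int b * \<beta> < 1"
    unfolding frac by linarith+
  ultimately obtain n j where j: "0 \<le> j" "j \<le> 2 ^ n"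
    "division_point p n j = of_int a + of_int b * \<beta>"
    using greedy_expansion_finite[of a b N] unfolding y'_def by blast
  have "division_point p (0 + n) (2 ^ n * \<lfloor>y\<rfloor> + j) = y"
    using division_point_self_similar[OF j(1,2), of p 0 "\<lfloor>y\<rfloor>"] j(3) frac by simp
  then show ?thesis by (rule that)
qed

lemma de_rham_image: "de_rham p ` laurent_ring 2 = laurent_ring \<beta>"
proof (intro equalityI subsetI)
  fix y assume "y \<in> de_rham p ` laurent_ring 2"
  then show "y \<in> laurent_ring \<beta>"
    using division_point_in_ring by (auto simp: laurent_ring_2 de_rham_dyadic)
next
  fix y assume "y \<in> laurent_ring \<beta>"
  then obtain n k where "division_point p n k = y" by (rule ring_division_point)
  then have "y = de_rham p (of_int k / 2 ^ n)" by (simp add: de_rham_dyadic)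
  then show "y \<in> de_rham p ` laurent_ring 2" using laurent_ring_2 by blast
qed

text \<open>
  For large \<open>N\<close>, \<open>\<gamma>\<inverse>\<close> carries the dyadic interval at \<open>x\<close> of stage \<open>N\<close> onto one of stage \<open>N + m\<close>, where
  \<open>2 powi m\<close> is the slope of \<open>\<gamma>\<close>, and preserves the relative position \<open>w \<in> [0,1]\<close> in these intervals.
  On both intervals \<open>h\<close> is an affine function of \<open>h w\<close>; eliminating \<open>h w\<close> leaves an affine relation
  between \<open>h z\<close> and \<open>h (\<gamma>\<inverse> z)\<close>, whose slope is the quotient of two lengths.
\<close>

lemma de_rham_intertwines:
  assumes x: "x \<in> split_line (laurent_ring 2)" and \<gamma>: "\<gamma> \<in> laurent_ring 2 \<times> int_powers 2"
  shows "\<exists>\<gamma>'\<in>laurent_ring \<beta> \<times> int_powers \<beta>. intertwines (de_rham p) \<gamma> \<gamma>' x"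
proof -
  interpret cod: affine_data "laurent_ring \<beta>" "int_powers \<beta>"
    by (rule affine_data_laurent) (use golden in simp)
  obtain i n where s: "fst \<gamma> = of_int i / 2 ^ n" using \<gamma> laurent_ring_2 by auto
  obtain m where l: "snd \<gamma> = 2 powi m" using \<gamma> by (auto simp: int_powers_def)
  obtain M where M: "\<And>N. M \<le> N \<Longrightarrow> \<exists>k::int.
      eventually (\<lambda>z. of_int k \<le> 2 ^ N * z \<and> 2 ^ N * z \<le> of_int k + 1) (side_filter x)"
    using side_filter_dyadic_interval[OF x] by blast
  \<comment> \<open>Beyond stage \<open>M\<close> to have an interval at \<open>x\<close>, beyond \<open>n\<close> to make the translation part a multiple of
    \<open>1/2^N\<close>, and large enough for the stage \<open>N + m\<close> of the preimage to be a natural number.\<close>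
  define N where "N = M + n + nat (- m)"
  obtain k :: int where k:
    "eventually (\<lambda>z. of_int k \<le> 2 ^ N * z \<and> 2 ^ N * z \<le> of_int k + 1) (side_filter x)"
    using M[of N] unfolding N_def by auto
  define N' where "N' = nat (int N + m)"
  define k' where "k' = k - i * 2 ^ (N - n)"
  have N': "int N' = int N + m" unfolding N'_def N_def by auto
  have pow: "2 ^ N' = 2 ^ N * (2 powi m :: real)"
    by (simp add: N' power_int_add flip: power_int_of_nat)
  have s': "2 ^ N * fst \<gamma> = of_int (i * 2 ^ (N - n))"
    unfolding s by (simp add: N_def field_simps flip: power_add)
  have rescale: "2 ^ N' * affine_back \<gamma> z = 2 ^ N * z - of_int (i * 2 ^ (N - n))" for z
    unfolding pow l s'[symmetric] by (simp add: field_simps)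
  define L where "L = mesh p N k * inverse (mesh p N' k')"
  define S where "S = division_point p N k + - (L * division_point p N' k')"
  have L: "L \<in> int_powers \<beta>"
    unfolding L_def by (intro cod.mult cod.inverse mesh_int_powers)
  have S: "S \<in> laurent_ring \<beta>"
    unfolding S_def by (intro cod.add cod.uminus cod.scale L division_point_in_ring)
  have "eventually (\<lambda>z. de_rham p z = L * de_rham p (affine_back \<gamma> z) + S) (side_filter x)"
    using k
  proof eventually_elim
    case (elim z)
    define w where "w = 2 ^ N * z - of_int k"
    have w: "0 \<le> w" "w \<le> 1" using elim by (simp_all add: w_def)
    have z: "z = (of_int k + w) / 2 ^ N" by (simp add: w_def)
    have z': "affine_back \<gamma> z = (of_int k' + w) / 2 ^ N'"
      using rescale[of z] by (simp add: w_def k'_def field_simps)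
    have "de_rham p z = division_point p N k + mesh p N k * de_rham p w"
      unfolding z by (rule de_rham_self_similar[OF w])
    moreover have "de_rham p (affine_back \<gamma> z) = division_point p N' k' + mesh p N' k' * de_rham p w"
      unfolding z' by (rule de_rham_self_similar[OF w])
    moreover have "L * mesh p N' k' = mesh p N k"
      unfolding L_def using mesh_pos[of N' k'] by simp
    ultimately show ?case unfolding S_def by (simp add: distrib_left flip: mult.assoc)
  qed
  then have "intertwines (de_rham p) \<gamma> (S, L) x" by (simp add: intertwines_def)
  then show ?thesis using L S by blast
qed

sublocale germ_conjugacy "laurent_ring 2" "int_powers 2" "laurent_ring \<beta>" "int_powers \<beta>" "de_rham p"
proof -
  interpret dom: affine_data "laurent_ring 2" "int_powers 2" by (rule affine_data_laurent) simp
  interpret cod: affine_data "laurent_ring \<beta>" "int_powers \<beta>"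
    by (rule affine_data_laurent) (use golden in simp)
  show "germ_conjugacy (laurent_ring 2) (int_powers 2) (laurent_ring \<beta>) (int_powers \<beta>) (de_rham p)"
    by unfold_locales
      (fact strict_mono_de_rham surj_de_rham de_rham_image | rule de_rham_intertwines; assumption)+
qed

lemma unit_interval_image: "split_map (de_rham p) ` unit_interval_of 2 = unit_interval_of \<beta>"
proof -
  let ?f = "split_map (de_rham p)"
  have ends: "?f (Plus 0) = Plus 0" "?f (Minus 1) = Minus 1"
    using de_rham_int[of 0] de_rham_int[of 1] by simp_all
  have le: "?f x \<le> ?f y \<longleftrightarrow> x \<le> y" for x y by (rule split_map_le_iff[OF mono])
  have "?f ` (A \<inter> {a..b}) = ?f ` A \<inter> {?f a..?f b}" for A a b
    unfolding image_def by (auto simp only: le atLeastAtMost_iff)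
  then show ?thesis
    unfolding unit_interval_of_def split_interval_def by (simp only: split_map_image ends)
qed

end

theorem proposition6p5:
  fixes \<beta> :: real
  assumes "\<beta> = (sqrt 5 + 1) / 2"
  shows
    "\<exists>\<Phi>. groupoid_hom (stein_unit_of 2) (stein_unit_of \<beta>) \<Phi> \<and>
         continuous_map (gtop (stein_unit_of 2)) (gtop (stein_unit_of \<beta>)) \<Phi> \<and>
         inj_on \<Phi> (arrows (stein_unit_of 2)) \<and>
         open_map (gtop (stein_unit_of 2)) (gtop (stein_unit_of \<beta>)) \<Phi> \<and>
         homeomorphic_map (subtopology (split_space_of 2) (unit_interval_of 2))
           (subtopology (split_space_of \<beta>) (unit_interval_of \<beta>)) (unit_map \<Phi>) \<and>
         (\<forall>x \<in> unit_interval_of 2. \<forall>y \<in> unit_interval_of 2.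
            x < y \<longleftrightarrow> unit_map \<Phi> x < unit_map \<Phi> y) \<and>
         (\<exists>\<Psi>. (\<forall>g \<in> arrows (stein_unit_of 2). \<Psi> g = \<Phi> g) \<and>
              groupoid_hom (stein_of 2) (stein_of \<beta>) \<Psi> \<and>
              continuous_map (gtop (stein_of 2)) (gtop (stein_of \<beta>)) \<Psi> \<and>
              inj_on \<Psi> (arrows (stein_of 2)) \<and>
              open_map (gtop (stein_of 2)) (gtop (stein_of \<beta>)) \<Psi> \<and>
              homeomorphic_map (split_space_of 2) (split_space_of \<beta>) (unit_map \<Psi>) \<and>
              (\<forall>x \<in> split_line_of 2. \<forall>y \<in> split_line_of 2.
                 x < y \<longleftrightarrow> unit_map \<Psi> x < unit_map \<Psi> y))"
proof -
  interpret golden_mean \<beta> "\<beta> - 1" by unfold_locales (simp_all add: assms)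
  have Y: "unit_interval_of 2 \<subseteq> split_line (laurent_ring 2)"
    by (auto simp: unit_interval_of_def split_interval_def)
  note Y = Y unit_interval_image
  show ?thesis
    unfolding stein_unit_of_def stein_of_def split_space_of_def
    by (intro exI[of _ stein_map] conjI ballI)
      (simp_all only: unit_map_stein_map split_map_less_iff[OF mono]
        groupoid_hom_stein_map continuous_stein_map inj_on_stein_map open_stein_map
        homeomorphic_split_map groupoid_hom_reduction[OF Y] continuous_reduction[OF Y]
        inj_on_reduction[OF Y] open_reduction[OF Y] homeomorphic_split_map_subtopology[OF Y])
qed

end
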